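(* Let $\mathfrak a\in(0,2)$, $L,\beta>0$ and $\rho\in(0,1)$. Then $N^{-\frac{\beta}{\mathfrak a\beta+1}}$ is the minimax rate for pointwise estimation of the coefficient function $f$, in the following sense: there exists an innovation distribution function $F_\varepsilon$ satisfying conditions (i) and (ii) of the context (with this $\mathfrak a$) such that for any $x\in[0,1]$ $$\liminf_{N\to\infty}\ \inf_{\tilde f}\ \sup_{f}\ \mathbb P_f\Big(\big|\tilde f(x)-f(x)\big|>N^{-\frac{\beta}{\mathfrak a\beta+1}}\Big)>0,$$ where the infimum is over all estimators $\tilde f$ measurable with respect to $\sigma(X_1,\dots,X_N)$, and the supremum is over all $f\in\mathcal H(L,\beta)$ with $0\le f\le\rho$.
   Context: **Hölder class.** For $\beta>0$ put $\langle\beta\rangle=\max\{m\in\mathbb N_0: m<\beta\}$. $f\in\mathcal H(L,\beta)$ means that $f$ is $\langle\beta\rangle$ times differentiable and $|f^{(\langle\beta\rangle)}(y)-f^{(\langle\beta\rangle)}(z)|\le L|y-z|^{\beta-\langle\beta\rangle}$ for all $y,z$ in the domain of the function ($[0,1]$ for the coefficient function $f$; $[0,\infty)$ for $F_\varepsilon$ below). **Model.** The coefficient function $f:[0,1]\to[0,\rho]$ lies in $\mathcal H(L,\beta)$ and is extended to $\mathbb R$ by $f(u)=f(0)$ for $u<0$ and $f(u)=f(1)$ for $u>1$. The innovations $(\varepsilon_k)_{k\in\mathbb Z}$ are i.i.d. with distribution function $F_\varepsilon$ such that, for some $\mathfrak c,\mathfrak c_g,\delta\in(0,\infty)$ and $L_\varepsilon,\beta_\varepsilon>0$,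 (i) as $y\downarrow0$, $F_\varepsilon(y)=\mathfrak c\,y^{\mathfrak a}+g(y)$ with $|g(y)|\le\mathfrak c_g\,y^{\mathfrak a+\delta}$ (so $\varepsilon_k\ge0$ a.s.), and $F_\varepsilon\in\mathcal H(L_\varepsilon,\beta_\varepsilon)$; (ii) $\mathbb E\varepsilon_1^p<\infty$ for $p=\max\{1,2\mathfrak a+\delta\}$. For $N\in\mathbb N$ the process satisfies $X_k=f(k/N)X_{k-1}+\varepsilon_k$ and is defined for all $k\in\mathbb Z$ by $X_k=\sum_{i\ge0}\big(\prod_{l=0}^{i-1}f(\tfrac{k-l}{N})\big)\varepsilon_{k-i}$. $\mathbb P_f$ denotes probability under coefficient function $f$. *)

theory Defs
  imports "HOL-Probability.Probability"
begin

definition strict_floor :: "real \<Rightarrow> nat" where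
  "strict_floor \<beta> = Max {m. real m < \<beta>}"

text \<open>
  The list of successive derivatives is given by the family \<open>d\<close>; derivatives are taken
  within the domain \<open>D\<close>, hence are one-sided at its boundary points, and only the values
  of \<open>f\<close> on \<open>D\<close> matter.  On the intervals used below they are unique.
\<close>

definition hoelder_class :: "real set \<Rightarrow> real \<Rightarrow> real \<Rightarrow> (real \<Rightarrow> real) set" where
  "hoelder_class D L \<beta> = {f. \<exists>d :: nat \<Rightarrow> real \<Rightarrow> real.
     (\<forall>u\<in>D. d 0 u = f u) \<and>
     (\<forall>m<strict_floor \<beta>. \<forall>u\<in>D. (d m has_real_derivative d (Suc m) u) (at u within D)) \<and>
     (\<forall>y\<in>D. \<forall>z\<in>D. \<bar>d (strict_floor \<beta>) y - d (strict_floor \<beta>) z\<bar>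
                       \<le> L * \<bar>y - z\<bar> powr (\<beta> - real (strict_floor \<beta>)))}"

definition coefficient_class :: "real \<Rightarrow> real \<Rightarrow> real \<Rightarrow> (real \<Rightarrow> real) set" where
  "coefficient_class L \<beta> \<rho> =
     {f \<in> hoelder_class {0..1} L \<beta>. \<forall>u\<in>{0..1}. 0 \<le> f u \<and> f u \<le> \<rho>}"

text \<open>
  An innovation law is represented by the distribution \<open>\<mu>\<close> on the real line whose
  distribution function is \<open>cdf \<mu>\<close>.  The expansion at \<open>0\<close> forces \<open>cdf \<mu> 0 = 0\<close>, so that
  \<open>\<mu>\<close> is concentrated on the positive half-line and \<open>y powr p\<close> is the ordinary power
  \<open>\<mu>\<close>-almost everywhere.
\<close>

definition innovation_law :: "real \<Rightarrow> real measure \<Rightarrow> bool" where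
  "innovation_law a \<mu> \<longleftrightarrow> real_distribution \<mu> \<and>
     (\<exists>c cg \<delta> L\<^sub>\<epsilon> \<beta>\<^sub>\<epsilon>. 0 < c \<and> 0 < cg \<and> 0 < \<delta> \<and> 0 < L\<^sub>\<epsilon> \<and> 0 < \<beta>\<^sub>\<epsilon> \<and>
       (\<exists>g. \<forall>\<^sub>F y in at_right 0. cdf \<mu> y = c * y powr a + g y \<and> \<bar>g y\<bar> \<le> cg * y powr (a + \<delta>)) \<and>
       cdf \<mu> \<in> hoelder_class {0..} L\<^sub>\<epsilon> \<beta>\<^sub>\<epsilon> \<and>
       integrable \<mu> (\<lambda>y. y powr max 1 (2 * a + \<delta>)))"

text \<open>
  The two-sided i.i.d. innovation sequence is realised as the coordinate process on the
  infinite product space.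
\<close>

definition innovation_space :: "real measure \<Rightarrow> (int \<Rightarrow> real) measure" where
  "innovation_space \<mu> = Pi\<^sub>M UNIV (\<lambda>_. \<mu>)"

definition extend_coeff :: "(real \<Rightarrow> real) \<Rightarrow> real \<Rightarrow> real" where
  "extend_coeff f u = (if u < 0 then f 0 else if u > 1 then f 1 else f u)"

definition tvar_process :: "(real \<Rightarrow> real) \<Rightarrow> nat \<Rightarrow> int \<Rightarrow> (int \<Rightarrow> real) \<Rightarrow> real" where
  "tvar_process f N k \<epsilon> =
     (\<Sum>i. (\<Prod>l<i. extend_coeff f (real_of_int (k - int l) / real N)) * \<epsilon> (k - int i))"

definition observations :: "(real \<Rightarrow> real) \<Rightarrow> nat \<Rightarrow> (int \<Rightarrow> real) \<Rightarrow> int \<Rightarrow> real" where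
  "observations f N \<epsilon> = (\<lambda>k\<in>{1..int N}. tvar_process f N k \<epsilon>)"

text \<open>
  The observations depend on the unknown \<open>f\<close> but an estimator must not, so measurability
  with respect to \<open>\<sigma>(X\<^sub>1, \<dots>, X\<^sub>N)\<close> is expressed by taking an estimator to be one
  measurable function of the observed values, used for every \<open>f\<close>.
\<close>

definition estimators :: "nat \<Rightarrow> ((int \<Rightarrow> real) \<Rightarrow> real \<Rightarrow> real) set" where
  "estimators N =
     {T. \<forall>u\<in>{0..1}. (\<lambda>y. T y u) \<in> borel_measurable (Pi\<^sub>M {1..int N} (\<lambda>_. borel))}"

end

(*
  Le Cam's method with two hypotheses: the zero coefficient against a bump of height of order
  N^(-beta/(a beta + 1)) and width h of order N^(-1/(a beta + 1)), centred at x.  The innovation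
  density is c y^(a-1) (1-y)^2 on [0,1].  It has compact support, so the process is bounded, and
  its squared Hellinger distance to its translate by d is of order d^a because a < 2.  Only about
  2 h N innovations are shifted, each by at most a multiple of h^beta, and h N h^(a beta) is of
  order one.  The affinity of the two laws of the observations, given the innovations up to time
  zero, is therefore bounded away from zero, and no estimator separates the two hypotheses.
*)

theory Submission
  imports Defs
begin

text \<open>Under the zero coefficient the observations are the innovations themselves, a product
  law, and the likelihood ratio of the bump is a product of one-step ratios of a translated
  innovation density to the original one. The translation f(k/N) X_(k-1) is random, but X_(k-1) is
  visible in the data, so integrating out the last innovation first bounds the affinity factor by
  factor. The start value X_0 is not observed: it carries the infinite past and, for x near 0, the
  constant extension of the bump to negative times. Being independent of the later innovations it
  can be frozen, and the observations under the zero coefficient do not depend on it. A translate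
  charges points beyond the support of the innovation law. The likelihood ratio therefore describes
  only an absolutely continuous part, and the change of measure is an inequality, in the direction
  that a lower bound on errors needs. The factor (1-y)^2 tames the right end of the density: a jump
  there would cost order d, which exceeds d^a once a > 1. Being a square, it also has a polynomial
  root.\<close>

section \<open>The innovation law\<close>

text \<open>The reciprocal of the Beta function at (a, 3): the innovations follow the Beta(a, 3)
  law.\<close>

definition innov_const :: "real \<Rightarrow> real" where
  "innov_const a = a * (a + 1) * (a + 2) / 2"

definition innov_density :: "real \<Rightarrow> real \<Rightarrow> real" where
  "innov_density a y =
     (if 0 \<le> y \<and> y \<le> 1 then innov_const a * (y powr (a - 1) * (1 - y)\<^sup>2) else 0)"

text \<open>Termwise antiderivative of the expanded density. It is the distribution function on
  [0,1] only, which is why its argument is later capped at 1.\<close>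

definition innov_cdf :: "real \<Rightarrow> real \<Rightarrow> real" where
  "innov_cdf a y = innov_const a *
     (y powr a / a - 2 * y powr (a + 1) / (a + 1) + y powr (a + 2) / (a + 2))"

definition innov_measure :: "real \<Rightarrow> real measure" where
  "innov_measure a = density lborel (innov_density a)"

lemma innov_const_pos: "0 < a \<Longrightarrow> 0 < innov_const a"
  by (simp add: innov_const_def)

lemma innov_density_nonneg: "0 < a \<Longrightarrow> 0 \<le> innov_density a y"
  using innov_const_pos[of a] by (simp add: innov_density_def)

lemma innov_density_measurable [measurable]: "innov_density a \<in> borel_measurable borel"
  unfolding innov_density_def by measurable

lemma innov_density_eq:
  assumes "0 \<le> y" "y \<le> 1"
  shows "innov_density a y =
    innov_const a * (y powr (a - 1) - 2 * y powr a + y powr (a + 1))"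
\<comment> \<open>At \<open>y = 0\<close> both sides vanish, since \<open>0 powr b = 0\<close> even
  for negative \<open>b\<close>.\<close>
proof (cases "y = 0")
  case False
  then have "y powr a = y powr (a - 1) * y" "y powr (a + 1) = y powr (a - 1) * y\<^sup>2"
    using assms by (simp_all add: powr_diff powr_add power2_eq_square)
  then show ?thesis
    using assms by (simp add: innov_density_def power2_eq_square algebra_simps)
qed (simp add: innov_density_def)

lemma innov_cdf_1: "0 < a \<Longrightarrow> innov_cdf a 1 = 1"
  by (simp add: innov_cdf_def innov_const_def divide_simps) (simp add: algebra_simps)

lemma has_integral_innov_density:
  assumes "0 < a" "0 \<le> y" "y \<le> 1"
  shows "(innov_density a has_integral innov_cdf a y) {0..y}"
proof -
  have "((\<lambda>t. innov_const a * (t powr (a - 1) - 2 * t powr a + t powr (a + 1)))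
      has_integral innov_const a *
        (y powr (a - 1 + 1) / (a - 1 + 1) - 2 * (y powr (a + 1) / (a + 1))
          + y powr (a + 1 + 1) / (a + 1 + 1))) {0..y}"
    using assms
    by (intro has_integral_mult_right has_integral_add has_integral_diff has_integral_powr_from_0) auto
  then have "(innov_density a has_integral innov_const a *
        (y powr (a - 1 + 1) / (a - 1 + 1) - 2 * (y powr (a + 1) / (a + 1))
          + y powr (a + 1 + 1) / (a + 1 + 1))) {0..y}"
    by (rule has_integral_eq[rotated]) (use assms in \<open>simp add: innov_density_eq\<close>)
  then show ?thesis
    by (simp add: innov_cdf_def add.commute add.left_commute)
qed

lemma emeasure_innov_measure_Icc:
  assumes "0 < a" "0 \<le> y" "y \<le> 1"
  shows "emeasure (innov_measure a) {0..y} = ennreal (innov_cdf a y)"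
proof -
  have "((\<lambda>t. innov_density a t * indicator {0..y} t) has_integral innov_cdf a y) UNIV"
  proof -
    have "((\<lambda>t. if t \<in> {0..y} then innov_density a t else 0) has_integral innov_cdf a y) UNIV"
      using has_integral_innov_density[OF assms] by (simp only: has_integral_restrict_UNIV)
    then show ?thesis
      by (rule has_integral_eq[rotated]) auto
  qed
  then have "(\<integral>\<^sup>+t. innov_density a t * indicator {0..y} t \<partial>lborel) = innov_cdf a y"
    by (intro nn_integral_has_integral_lborel)
      (auto intro!: mult_nonneg_nonneg innov_density_nonneg assms)
  then show ?thesis
    unfolding innov_measure_def using assms
    by (subst emeasure_density)
      (auto simp: ennreal_mult innov_density_nonneg ennreal_indicator)
qed

lemma sets_innov_measure [measurable_cong, simp]: "sets (innov_measure a) = sets borel"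
  by (simp add: innov_measure_def)

lemma space_innov_measure [simp]: "space (innov_measure a) = UNIV"
  by (simp add: innov_measure_def)

lemma nn_integral_innov_measure:
  assumes "0 < a" and [measurable]: "g \<in> borel_measurable borel"
  shows "(\<integral>\<^sup>+y. g y \<partial>innov_measure a) = (\<integral>\<^sup>+y. ennreal (innov_density a y) * g y \<partial>lborel)"
  unfolding innov_measure_def by (subst nn_integral_density) auto

lemma emeasure_innov_measure_outside:
  assumes "A \<in> sets borel" "A \<inter> {0..1} = {}"
  shows "emeasure (innov_measure a) A = 0"
proof -
  have "(\<integral>\<^sup>+t. ennreal (innov_density a t) * indicator A t \<partial>lborel) = (\<integral>\<^sup>+(t::real). 0 \<partial>lborel)"
    using assms(2) by (intro nn_integral_cong)
      (auto simp: innov_density_def indicator_def)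
  then show ?thesis
    unfolding innov_measure_def using assms(1) by (subst emeasure_density) auto
qed

lemma prob_space_innov_measure:
  assumes "0 < a"
  shows "prob_space (innov_measure a)"
proof
  have "emeasure (innov_measure a) (space (innov_measure a)) =
    emeasure (innov_measure a) ({0..1} \<union> - {0..1})"
    by simp
  also have "\<dots> = emeasure (innov_measure a) {0..1} + emeasure (innov_measure a) (- {0..1})"
    by (rule plus_emeasure[symmetric]) auto
  also have "\<dots> = 1"
    using assms
    by (simp add: emeasure_innov_measure_Icc innov_cdf_1 emeasure_innov_measure_outside)
  finally show "emeasure (innov_measure a) (space (innov_measure a)) = 1" .
qed

lemma AE_innov_measure: "AE y in innov_measure a. 0 \<le> y \<and> y \<le> 1"
  by (rule AE_I[where N = "- {0..1}"]) (auto simp: emeasure_innov_measure_outside)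

lemma innov_cdf_nonneg:
  assumes "0 < a" "0 \<le> y" "y \<le> 1"
  shows "0 \<le> innov_cdf a y"
  using has_integral_nonneg[OF has_integral_innov_density[OF assms]] innov_density_nonneg assms(1)
  by blast

lemma cdf_innov_measure:
  assumes "0 < a" "0 \<le> y"
  shows "cdf (innov_measure a) y = innov_cdf a (min y 1)"
proof -
  interpret prob_space "innov_measure a"
    by (rule prob_space_innov_measure) fact
  have "measure (innov_measure a) {..y} = measure (innov_measure a) {0..min y 1}"
  proof (rule finite_measure_eq_AE)
    show "AE t in innov_measure a. t \<in> {..y} \<longleftrightarrow> t \<in> {0..min y 1}"
      using AE_innov_measure[of a] by eventually_elim auto
  qed simp_all
  also have "\<dots> = innov_cdf a (min y 1)"
    using assms by (simp add: measure_def emeasure_innov_measure_Icc innov_cdf_nonneg)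
  finally show ?thesis
    by (simp add: cdf_def)
qed

section \<open>Hoelder regularity of the distribution function and its expansion at zero\<close>

lemma strict_floor_eqI:
  assumes "real m < \<beta>" "\<beta> \<le> real m + 1"
  shows "strict_floor \<beta> = m"
  unfolding strict_floor_def
proof (rule Max_eqI)
  have "{m. real m < \<beta>} \<subseteq> {..m}"
    using assms(2) by auto
  then show "finite {m. real m < \<beta>}"
    by (rule finite_subset) simp
qed (use assms in auto)

text \<open>Subadditivity of a concave power: after division by \<open>y\<close> the two fractions
  add up to 1, and a number in [0,1] does not decrease when raised to a power at most 1.\<close>

lemma powr_diff_le_powr:
  fixes a y z :: real
  assumes "0 < a" "a \<le> 1" "0 \<le> z" "z \<le> y"
  shows "y powr a - z powr a \<le> (y - z) powr a"
proof (cases "y = 0")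
  case False
  then have y: "0 < y"
    using assms by simp
  have *: "t \<le> t powr a" if "0 \<le> t" "t \<le> 1" for t :: real
    using powr_mono'[of a 1 t] assms that by simp
  have "y powr a * 1 \<le> y powr a * (((y - z) / y) powr a + (z / y) powr a)"
  proof (rule mult_left_mono)
    have "1 = (y - z) / y + z / y"
      using y by (simp add: field_simps)
    also have "\<dots> \<le> ((y - z) / y) powr a + (z / y) powr a"
      using assms y by (intro add_mono *) auto
    finally show "1 \<le> ((y - z) / y) powr a + (z / y) powr a" .
  qed simp
  also have "\<dots> = (y - z) powr a + z powr a"
    using y assms by (simp add: powr_divide distrib_left)
  finally show ?thesis
    by simp
qed (use assms in simp)

text \<open>Powers with a negative exponent are singular at 0, so integrals over subintervals are
  obtained as differences of integrals that start at 0.\<close>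

lemma has_integral_real_diff:
  fixes f :: "real \<Rightarrow> real"
  assumes x: "(f has_integral A) {x..z}" and y: "(f has_integral B) {x..y}" and "x \<le> z" "z \<le> y"
  shows "(f has_integral B - A) {z..y}"
proof -
  have "f integrable_on {x..y}"
    using y by blast
  then have "f integrable_on {z..y}"
    by (rule integrable_subinterval_real) (use assms in auto)
  then have i: "(f has_integral integral {z..y} f) {z..y}"
    by (rule integrable_integral)
  then have "(f has_integral A + integral {z..y} f) {x..y}"
    by (rule has_integral_combine[OF assms(3,4) x])
  then have "B = A + integral {z..y} f"
    by (rule has_integral_unique[OF y])
  with i show ?thesis
    by simp
qed

text \<open>The two summands of the constant belong to two regimes. For \<open>a \<le> 1\<close> the
  density is dominated by \<open>innov_const a * t powr (a - 1)\<close>, whose integral brings the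
  factor \<open>1 / a\<close>; for \<open>a > 1\<close> it is bounded by
  \<open>innov_const a\<close> and the distribution function is Lipschitz.\<close>

lemma innov_cdf_diff_le:
  assumes "0 < a" "0 \<le> z" "z \<le> y" "y \<le> 1"
  shows "\<bar>innov_cdf a y - innov_cdf a z\<bar> \<le>
    (innov_const a / a + innov_const a) * (y - z) powr min a 1"
proof -
  have I: "(innov_density a has_integral innov_cdf a y - innov_cdf a z) {z..y}"
    by (rule has_integral_real_diff[OF has_integral_innov_density has_integral_innov_density])
      (use assms in auto)
  have pos: "0 \<le> innov_cdf a y - innov_cdf a z"
    using has_integral_nonneg[OF I] innov_density_nonneg assms(1) by blast
  have c: "0 < innov_const a"
    using assms by (simp add: innov_const_pos)
  have "innov_cdf a y - innov_cdf a z \<le> (innov_const a / a + innov_const a) * (y - z) powr min a 1"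
  proof (cases "a \<le> 1")
    case True
    have "((\<lambda>t. innov_const a * t powr (a - 1)) has_integral
        innov_const a * (y powr a / a - z powr a / a)) {z..y}"
    proof -
      have P: "((\<lambda>t. t powr (a - 1)) has_integral (w powr a / a)) {0..w}" if "0 \<le> w" for w
        using has_integral_powr_from_0[of "a - 1" w] assms that by simp
      have "((\<lambda>t. t powr (a - 1)) has_integral (y powr a / a - z powr a / a)) {z..y}"
        by (rule has_integral_real_diff[OF P P]) (use assms in auto)
      then show ?thesis
        by (rule has_integral_mult_right)
    qed
    then have "innov_cdf a y - innov_cdf a z \<le> innov_const a * (y powr a / a - z powr a / a)"
    proof (rule has_integral_le[OF I])
      fix t assume "t \<in> {z..y}"
      then show "innov_density a t \<le> innov_const a * t powr (a - 1)"
        using assms c by (auto simp: innov_density_def intro!: mult_left_mono mult_right_le_one_le power_le_one)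
    qed
    also have "\<dots> = innov_const a / a * (y powr a - z powr a)"
      by (simp add: right_diff_distrib diff_divide_distrib)
    also have "\<dots> \<le> innov_const a / a * (y - z) powr a"
      using c assms True by (intro mult_left_mono powr_diff_le_powr) auto
    also have "\<dots> \<le> (innov_const a / a + innov_const a) * (y - z) powr a"
      using c by (intro mult_right_mono) auto
    finally show ?thesis
      using True by (simp add: min_def)
  next
    case False
    have "innov_cdf a y - innov_cdf a z \<le> (y - z) * innov_const a"
    proof (rule has_integral_le[OF I])
      show "((\<lambda>t. innov_const a) has_integral (y - z) * innov_const a) {z..y}"
        using has_integral_const_real[of "innov_const a" z y] assms by simp
      fix t assume "t \<in> {z..y}"
      moreover have "t powr (a - 1) * (1 - t)\<^sup>2 \<le> 1 * 1"
        using False assms \<open>t \<in> {z..y}\<close>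
        by (intro mult_mono powr_le1 power_le_one) auto
      ultimately show "innov_density a t \<le> innov_const a"
        using c mult_left_mono[of "t powr (a - 1) * (1 - t)\<^sup>2" 1 "innov_const a"]
        by (auto simp: innov_density_def)
    qed
    also have "\<dots> \<le> (innov_const a / a + innov_const a) * (y - z)"
      using c assms by (simp add: algebra_simps)
    finally show ?thesis
      using False assms by (simp add: min_def)
  qed
  with pos show ?thesis
    by simp
qed

text \<open>An exponent of at most 1 has strict floor 0, so no derivative is demanded and the
  constant family is a witness. Capping the arguments at 1 only shrinks their distance.\<close>

lemma cdf_innov_measure_hoelder:
  assumes "0 < a"
  shows "cdf (innov_measure a) \<in>
    hoelder_class {0..} (innov_const a / a + innov_const a) (min a 1)"
proof -
  have "strict_floor (min a 1) = 0"
    using assms by (intro strict_floor_eqI) auto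
  moreover have "\<bar>cdf (innov_measure a) y - cdf (innov_measure a) z\<bar> \<le>
      (innov_const a / a + innov_const a) * \<bar>y - z\<bar> powr min a 1"
    if "0 \<le> y" "0 \<le> z" for y z
  proof -
    have *: "\<bar>cdf (innov_measure a) y - cdf (innov_measure a) z\<bar> \<le>
      (innov_const a / a + innov_const a) * \<bar>y - z\<bar> powr min a 1"
      if "0 \<le> z" "z \<le> y" for y z
    proof -
      have "\<bar>cdf (innov_measure a) y - cdf (innov_measure a) z\<bar> =
        \<bar>innov_cdf a (min y 1) - innov_cdf a (min z 1)\<bar>"
        using that assms by (simp add: cdf_innov_measure)
      also have "\<dots> \<le> (innov_const a / a + innov_const a) * (min y 1 - min z 1) powr min a 1"
        using that assms by (intro innov_cdf_diff_le) auto
      also have "\<dots> \<le> (innov_const a / a + innov_const a) * \<bar>y - z\<bar> powr min a 1"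
        using that assms innov_const_pos[of a]
        by (intro mult_left_mono powr_mono2) auto
      finally show ?thesis .
    qed
    show ?thesis
      using *[of y z] *[of z y] that by (cases "z \<le> y") (auto simp: abs_minus_commute)
  qed
  ultimately show ?thesis
    unfolding hoelder_class_def mem_Collect_eq
    by (intro exI[of _ "\<lambda>_. cdf (innov_measure a)"]) simp
qed

lemma innovation_law_innov_measure:
  assumes "0 < a"
  shows "innovation_law a (innov_measure a)"
proof -
  interpret prob_space "innov_measure a"
    by (rule prob_space_innov_measure) fact
  have rd: "real_distribution (innov_measure a)"
    by unfold_locales auto
  have c: "0 < innov_const a"
    using assms by (rule innov_const_pos)
  \<comment> \<open>The remainder after the leading term. It consists of multiples of
    \<open>y powr (a + 1)\<close> and \<open>y powr (a + 2)\<close>, hence \<delta> = 1, and the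
    crude coefficients 2 and 1 give the constant 3.\<close>
  define g where "g y = cdf (innov_measure a) y - innov_const a / a * y powr a" for y
  have g: "\<forall>\<^sub>F y in at_right 0. cdf (innov_measure a) y = innov_const a / a * y powr a + g y \<and>
      \<bar>g y\<bar> \<le> 3 * innov_const a * y powr (a + 1)"
    unfolding eventually_at_right_field
  proof (intro exI[of _ 1] conjI allI impI)
    fix y :: real assume y: "0 < y" "y < 1"
    show "cdf (innov_measure a) y = innov_const a / a * y powr a + g y"
      by (simp add: g_def)
    have "g y = innov_const a * (y powr (a + 2) / (a + 2) - 2 * y powr (a + 1) / (a + 1))"
      using y assms by (simp add: g_def cdf_innov_measure innov_cdf_def algebra_simps)
    also have "\<bar>\<dots>\<bar> = innov_const a * \<bar>y powr (a + 2) / (a + 2) - 2 * y powr (a + 1) / (a + 1)\<bar>"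
      using c by (simp add: abs_mult)
    also have "\<dots> \<le> innov_const a * (y powr (a + 1) + 2 * y powr (a + 1))"
    proof (intro mult_left_mono order_trans[OF abs_triangle_ineq4] add_mono)
      have "y powr (a + 2) / (a + 2) \<le> y powr (a + 2) / 1"
        using assms by (intro divide_left_mono) auto
      also have "\<dots> \<le> y powr (a + 1)"
        using y powr_mono'[of "a + 1" "a + 2" y] by simp
      finally show "\<bar>y powr (a + 2) / (a + 2)\<bar> \<le> y powr (a + 1)"
        using assms by simp
      have "2 * y powr (a + 1) / (a + 1) \<le> 2 * y powr (a + 1) / 1"
        using assms by (intro divide_left_mono) auto
      then show "\<bar>2 * y powr (a + 1) / (a + 1)\<bar> \<le> 2 * y powr (a + 1)"
        using assms by simp
    qed (use c in auto)
    finally show "\<bar>g y\<bar> \<le> 3 * innov_const a * y powr (a + 1)"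
      by simp
  qed simp
  have "integrable (innov_measure a) (\<lambda>y. y powr max 1 (2 * a + 1))"
  proof (rule integrable_const_bound[where B = 1])
    show "AE y in innov_measure a. norm (y powr max 1 (2 * a + 1)) \<le> 1"
      using AE_innov_measure[of a] by eventually_elim (auto intro!: powr_le1)
  qed measurable
  note int = this
  have "0 < innov_const a / a" "0 < 3 * innov_const a" "0 < innov_const a / a + innov_const a"
    "0 < min a 1"
    using c assms by (auto intro: add_pos_pos)
  then show ?thesis
    unfolding innovation_law_def
    by (intro conjI rd exI[of _ g] exI[of _ "innov_const a / a"] exI[of _ "3 * innov_const a"]
      exI[of _ 1] exI[of _ "innov_const a / a + innov_const a"] exI[of _ "min a 1"] zero_less_one
      g int cdf_innov_measure_hoelder[OF assms])
qed

section \<open>Hellinger affinity under a shift\<close>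

text \<open>The minorant used for the affinity is negative near the ends of its interval, while
  nonnegative integrals only see positive parts. Continuity provides integrability and measurability
  of the positive part.\<close>

lemma has_integral_le_nn_integral:
  fixes f u :: "real \<Rightarrow> real"
  assumes int: "(f has_integral I) {x..y}" and cont: "continuous_on {x..y} f"
    and le: "\<And>t. t \<in> {x..y} \<Longrightarrow> f t \<le> u t"
  shows "ennreal I \<le> (\<integral>\<^sup>+t. ennreal (u t) \<partial>lborel)"
proof -
  define v where "v t = (if t \<in> {x..y} then max 0 (f t) else 0)" for t
  have c: "continuous_on {x..y} (\<lambda>t. max 0 (f t))"
    by (intro continuous_intros cont)
  then obtain J where J: "((\<lambda>t. max 0 (f t)) has_integral J) {x..y}"
    using integrable_continuous_real by blast
  have "I \<le> J"
    by (rule has_integral_le[OF int J]) simp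
  moreover have "(\<integral>\<^sup>+t. ennreal (v t) \<partial>lborel) = ennreal J"
  proof (rule nn_integral_has_integral_lborel)
    show "v \<in> borel_measurable borel"
      unfolding v_def using c by (intro borel_measurable_continuous_on_if) auto
    show "(v has_integral J) UNIV"
      unfolding v_def using J by (simp only: has_integral_restrict_UNIV)
  qed (simp add: v_def)
  moreover have "(\<integral>\<^sup>+t. ennreal (v t) \<partial>lborel) \<le> (\<integral>\<^sup>+t. ennreal (u t) \<partial>lborel)"
  proof (rule nn_integral_mono)
    fix t
    show "ennreal (v t) \<le> ennreal (u t)"
      using le[of t] by (auto simp: v_def max_def ennreal_neg intro: ennreal_leI)
  qed
  ultimately show ?thesis
    by (metis ennreal_leI order_trans)
qed

text \<open>With d half the shift, one \<open>1 / a\<close> pays for the mass of [0,d] and the other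
  for the integral of \<open>d^2 * m powr (a - 1)\<close>. The term \<open>1 / (2 - a)\<close> comes
  from \<open>d^2 * m powr (a - 3)\<close> over [d,1], which is of order d^a exactly because a <
  2.\<close>

definition hellinger_const :: "real \<Rightarrow> real" where
  "hellinger_const a = innov_const a * (2 / a + 1 / (2 - a))"

lemma hellinger_const_pos: "0 < a \<Longrightarrow> a < 2 \<Longrightarrow> 0 < hellinger_const a"
  unfolding hellinger_const_def by (intro mult_pos_pos innov_const_pos add_pos_pos) auto

text \<open>
  Centring the two densities at their midpoint makes the product symmetric in the shift, so that
  no first-order term appears; this is what makes the bound work for exponents above \<open>1\<close>.
\<close>

lemma sqrt_innov_density_mult_ge:
  assumes a: "0 < a" "a < 2" and d: "0 < d" "d \<le> m" "m \<le> 1"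
  shows "innov_density a m - innov_const a * d\<^sup>2 * m powr (a - 1) - innov_const a * d\<^sup>2 * m powr (a - 3)
    \<le> sqrt (innov_density a (m + d) * innov_density a (m - d))"
proof -
  have c: "0 < innov_const a"
    using a by (simp add: innov_const_pos)
  \<comment> \<open>\<open>w\<close> factors as \<open>(1 - (m + d)) * (1 - (m - d))\<close>, the
    root of the product of the two quadratic factors.\<close>
  define w where "w = (1 - m)\<^sup>2 - d\<^sup>2"
  have lhs: "innov_density a m - innov_const a * d\<^sup>2 * m powr (a - 1) - innov_const a * d\<^sup>2 * m powr (a - 3)
    = innov_const a * (m powr (a - 1) * w - d\<^sup>2 * m powr (a - 3))"
    using d by (simp add: innov_density_def w_def algebra_simps)
  show ?thesis
  proof (cases "m + d \<le> 1")
    case True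
    have m: "0 < m"
      using d by simp
    have w: "w = (1 - (m + d)) * (1 - (m - d))"
      by (simp add: w_def power2_eq_square algebra_simps)
    have w0: "0 \<le> w" "w \<le> 1"
      unfolding w using True d by (auto intro!: mult_nonneg_nonneg mult_le_one)
    \<comment> \<open>\<open>(m + d) * (m - d) = m^2 * (1 - t)\<close>. Since the exponent
      \<open>(a - 1) / 2\<close> is below 1, replacing \<open>(1 - t) powr ((a - 1) / 2)\<close> by
      \<open>1 - t\<close> gives a lower bound that is linear in \<open>t\<close>.\<close>
    define t where "t = d\<^sup>2 / m\<^sup>2"
    have t: "0 \<le> t" "t \<le> 1"
      using d by (auto simp: t_def power_mono)
    have md: "m\<^sup>2 - d\<^sup>2 = m\<^sup>2 * (1 - t)"
      using m by (simp add: t_def field_simps)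
    have "m powr (a - 1) * w - d\<^sup>2 * m powr (a - 3) \<le> m powr (a - 1) * w - d\<^sup>2 * m powr (a - 3) * w"
      using w0 by (simp add: mult_left_le)
    also have "\<dots> = m powr (a - 1) * (1 - t) * w"
    proof -
      have "m powr (a - 3) = m powr (a - 1) / m\<^sup>2"
        using m powr_diff[of m "a - 1" 2] by simp
      then show ?thesis
        by (simp add: t_def algebra_simps)
    qed
    also have "\<dots> \<le> m powr (a - 1) * (1 - t) powr ((a - 1) / 2) * w"
    proof (intro mult_right_mono mult_left_mono w0)
      show "1 - t \<le> (1 - t) powr ((a - 1) / 2)"
        using powr_mono'[of "(a - 1) / 2" 1 "1 - t"] t a by simp
    qed simp
    also have "\<dots> = (m\<^sup>2 * (1 - t)) powr ((a - 1) / 2) * w"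
    proof -
      have "m powr (a - 1) = (m powr 2) powr ((a - 1) / 2)"
        by (simp only: powr_powr) (simp add: diff_divide_distrib)
      then show ?thesis
        using m t by (simp add: powr_mult)
    qed
    also have "\<dots> = ((m + d) * (m - d)) powr ((a - 1) / 2) * w"
    proof -
      have "m\<^sup>2 * (1 - t) = (m + d) * (m - d)"
        unfolding md[symmetric] by (simp add: power2_eq_square algebra_simps)
      then show ?thesis
        by simp
    qed
    finally have *: "m powr (a - 1) * w - d\<^sup>2 * m powr (a - 3) \<le>
        ((m + d) * (m - d)) powr ((a - 1) / 2) * w" .
    have "innov_density a (m + d) * innov_density a (m - d) =
        (innov_const a)\<^sup>2 * (((m + d) * (m - d)) powr (a - 1) * w\<^sup>2)"
      using d True by (simp add: innov_density_def w power2_eq_square powr_mult mult_ac)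
    also have "\<dots> = (innov_const a * (((m + d) * (m - d)) powr ((a - 1) / 2) * w))\<^sup>2"
      by (simp add: power_mult_distrib power2_eq_square[of "_ powr _"] flip: powr_add)
    finally have "sqrt (innov_density a (m + d) * innov_density a (m - d)) =
        innov_const a * (((m + d) * (m - d)) powr ((a - 1) / 2) * w)"
      using c w0 by (simp add: real_sqrt_abs)
    with * lhs c show ?thesis
      by (simp add: mult_left_mono)
  next
    case False
    \<comment> \<open>Here \<open>m + d\<close> has left the support and the root is 0; the claim
      survives because \<open>w \<le> 0\<close> makes the left side nonpositive.\<close>
    have "(1 - m)\<^sup>2 \<le> d\<^sup>2"
      using False d by (intro power_mono) auto
    then have "m powr (a - 1) * w \<le> 0"
      by (simp add: w_def mult_nonneg_nonpos)
    moreover have "0 \<le> d\<^sup>2 * m powr (a - 3)"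
      by simp
    ultimately have "m powr (a - 1) * w - d\<^sup>2 * m powr (a - 3) \<le> 0"
      by linarith
    then have "innov_const a * (m powr (a - 1) * w - d\<^sup>2 * m powr (a - 3)) \<le> 0"
      using c by (simp add: mult_nonneg_nonpos)
    also have "0 \<le> sqrt (innov_density a (m + d) * innov_density a (m - d))"
      using a by (simp add: innov_density_nonneg)
    finally show ?thesis
      using lhs by simp
  qed
qed

lemma hellinger_affinity_shift_ge:
  assumes a: "0 < a" "a < 2" and \<Delta>: "0 < \<Delta>" "\<Delta> \<le> 1"
  shows "ennreal (1 - hellinger_const a * \<Delta> powr a) \<le>
    (\<integral>\<^sup>+y. ennreal (sqrt (innov_density a y * innov_density a (y - \<Delta>))) \<partial>lborel)"
proof -
  \<comment> \<open>Half the shift: the final substitution \<open>y = m + d\<close> turns the pair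
    \<open>y\<close>, \<open>y - \<Delta>\<close> into \<open>m + d\<close>, \<open>m - d\<close>.
    The pointwise bound requires \<open>d \<le> m\<close>, so only [d,1] is integrated.\<close>
  define d where "d = \<Delta> / 2"
  have d: "0 < d" "d \<le> 1"
    using \<Delta> by (auto simp: d_def)
  have c: "0 < innov_const a"
    using a by (simp add: innov_const_pos)
  let ?l = "\<lambda>m. innov_density a m - innov_const a * d\<^sup>2 * m powr (a - 1) - innov_const a * d\<^sup>2 * m powr (a - 3)"
  let ?I = "(innov_cdf a 1 - innov_cdf a d) - innov_const a * d\<^sup>2 * (1 powr a / a - d powr a / a)
      - innov_const a * d\<^sup>2 * (1 powr (a - 2) / (a - 2) - d powr (a - 2) / (a - 2))"
  have I: "(?l has_integral ?I) {d..1}"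
  proof (intro has_integral_diff has_integral_mult_right)
    show "(innov_density a has_integral innov_cdf a 1 - innov_cdf a d) {d..1}"
      by (rule has_integral_real_diff[OF has_integral_innov_density has_integral_innov_density])
        (use a d in auto)
    have P: "((\<lambda>t. t powr (a - 1)) has_integral (w powr a / a)) {0..w}" if "0 \<le> w" for w
      using has_integral_powr_from_0[of "a - 1" w] a that by simp
    show "((\<lambda>t. t powr (a - 1)) has_integral (1 powr a / a - d powr a / a)) {d..1}"
      by (rule has_integral_real_diff[OF P P]) (use d in auto)
    show "((\<lambda>m. m powr (a - 3)) has_integral
        (1 powr (a - 2) / (a - 2) - d powr (a - 2) / (a - 2))) {d..1}"
    proof (rule fundamental_theorem_of_calculus)
      fix m assume m: "m \<in> {d..1}"
      have "((\<lambda>m. m powr (a - 2) / (a - 2)) has_real_derivative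
          (a - 2) * m powr (a - 2 - 1) / (a - 2)) (at m)"
        using d m by (intro DERIV_cdivide has_real_derivative_powr) auto
      then show "((\<lambda>m. m powr (a - 2) / (a - 2)) has_vector_derivative m powr (a - 3)) (at m within {d..1})"
        using a by (simp add: has_field_derivative_at_within has_real_derivative_iff_has_vector_derivative[symmetric])
    qed (use d in simp)
  qed
  have cont: "continuous_on {d..1} ?l"
  proof -
    have "continuous_on {d..1} (\<lambda>m. innov_const a * (m powr (a - 1) * (1 - m)\<^sup>2)
        - innov_const a * d\<^sup>2 * m powr (a - 1) - innov_const a * d\<^sup>2 * m powr (a - 3))"
      using d by (intro continuous_intros) auto
    then show ?thesis
      by (rule continuous_on_eq) (use d in \<open>auto simp: innov_density_def\<close>)
  qed
  \<comment> \<open>The terms of \<open>innov_cdf\<close> after the leading one add up to a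
    nonpositive correction.\<close>
  have cdf: "innov_cdf a d \<le> innov_const a * (d powr a / a)"
  proof -
    have "d powr (a + 2) / (a + 2) \<le> 2 * d powr (a + 1) / (a + 1)"
      using a d powr_mono'[of "a + 1" "a + 2" d] powr_ge_zero[of d "a + 1"]
      by (intro frac_le) (auto simp del: powr_ge_zero)
    then show ?thesis
      unfolding innov_cdf_def using c by (intro mult_left_mono) auto
  qed
  have d2: "d\<^sup>2 \<le> d powr a"
    using powr_mono'[of a 2 d] a d by simp
  have t2: "innov_const a * d\<^sup>2 * (1 powr a / a - d powr a / a) \<le> innov_const a * (d powr a / a)"
  proof -
    have "d\<^sup>2 * (1 powr a / a - d powr a / a) \<le> d powr a * (1 / a)"
      using d2 a d by (intro mult_mono) (auto simp: divide_right_mono powr_le1 diff_divide_distrib[symmetric])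
    then have "innov_const a * (d\<^sup>2 * (1 powr a / a - d powr a / a)) \<le> innov_const a * (d powr a * (1 / a))"
      using c by (intro mult_left_mono) auto
    then show ?thesis
      by (simp add: mult.assoc)
  qed
  have t3: "innov_const a * d\<^sup>2 * (1 powr (a - 2) / (a - 2) - d powr (a - 2) / (a - 2))
      \<le> innov_const a * (d powr a / (2 - a))"
  proof -
    have e: "1 powr (a - 2) / (a - 2) - d powr (a - 2) / (a - 2) = (d powr (a - 2) - 1) / (2 - a)"
      using a by (simp add: field_simps)
    have "d\<^sup>2 * ((d powr (a - 2) - 1) / (2 - a)) \<le> d\<^sup>2 * (d powr (a - 2) / (2 - a))"
      using a by (intro mult_left_mono divide_right_mono) auto
    also have "\<dots> = d powr a / (2 - a)"
      using d by (simp add: powr_diff)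
    finally have "innov_const a * (d\<^sup>2 * (1 powr (a - 2) / (a - 2) - d powr (a - 2) / (a - 2)))
        \<le> innov_const a * (d powr a / (2 - a))"
      unfolding e using c by (intro mult_left_mono) auto
    then show ?thesis
      by (simp only: mult.assoc)
  qed
  have "hellinger_const a * \<Delta> powr a \<ge> hellinger_const a * d powr a"
    using \<Delta> a hellinger_const_pos[OF a] by (intro mult_left_mono powr_mono2) (auto simp: d_def)
  moreover have "hellinger_const a * d powr a = innov_const a * (d powr a / a) +
      innov_const a * (d powr a / a) + innov_const a * (d powr a / (2 - a))"
    by (simp add: hellinger_const_def algebra_simps)
  ultimately have "1 - hellinger_const a * \<Delta> powr a \<le> ?I"
    using cdf t2 t3 a by (simp only: innov_cdf_1)
  then have "ennreal (1 - hellinger_const a * \<Delta> powr a) \<le> ennreal ?I"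
    by (rule ennreal_leI)
  also have "\<dots> \<le> (\<integral>\<^sup>+m. ennreal (sqrt (innov_density a (m + d) * innov_density a (m - d))) \<partial>lborel)"
    by (rule has_integral_le_nn_integral[OF I cont]) (use a d in \<open>auto intro!: sqrt_innov_density_mult_ge\<close>)
  also have "\<dots> = (\<integral>\<^sup>+y. ennreal (sqrt (innov_density a y * innov_density a (y - \<Delta>))) \<partial>lborel)"
    by (subst nn_integral_real_affine[of _ 1 d]) (auto simp: d_def add.commute)
  finally show ?thesis .
qed

section \<open>Change of measure for the autoregression\<close>

text \<open>Density of the absolutely continuous part of the translated law with respect to the
  innovation law. Where the denominator vanishes the quotient is 0, so translated mass outside the
  support is dropped.\<close>

definition innov_ratio :: "real \<Rightarrow> real \<Rightarrow> real \<Rightarrow> real" where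
  "innov_ratio a \<Delta> y = innov_density a (y - \<Delta>) / innov_density a y"

lemma innov_ratio_nonneg: "0 < a \<Longrightarrow> 0 \<le> innov_ratio a \<Delta> y"
  by (simp add: innov_ratio_def innov_density_nonneg)

lemma innov_ratio_measurable [measurable (raw)]:
  assumes [measurable]: "f \<in> borel_measurable M" "g \<in> borel_measurable M"
  shows "(\<lambda>x. innov_ratio a (f x) (g x)) \<in> borel_measurable M"
  unfolding innov_ratio_def by measurable

text \<open>Cancelling the density gives the translated density wherever the original one is
  nonzero, and 0 elsewhere; this loss is the reason for the inequality. The rest is a change of
  variable.\<close>

lemma nn_integral_innov_ratio_le_shift:
  assumes a: "0 < a" and [measurable]: "g \<in> borel_measurable borel"
  shows "(\<integral>\<^sup>+y. g y * ennreal (innov_ratio a \<Delta> y) \<partial>innov_measure a) \<le>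
    (\<integral>\<^sup>+y. g (\<Delta> + y) \<partial>innov_measure a)"
proof -
  have "(\<integral>\<^sup>+y. g y * ennreal (innov_ratio a \<Delta> y) \<partial>innov_measure a) =
      (\<integral>\<^sup>+y. ennreal (innov_density a y) * (g y * ennreal (innov_ratio a \<Delta> y)) \<partial>lborel)"
    by (rule nn_integral_innov_measure[OF a]) measurable
  also have "\<dots> \<le> (\<integral>\<^sup>+y. ennreal (innov_density a (y - \<Delta>)) * g y \<partial>lborel)"
  proof (rule nn_integral_mono)
    fix y
    have "innov_density a y * innov_ratio a \<Delta> y \<le> innov_density a (y - \<Delta>)"
      using a by (simp add: innov_ratio_def innov_density_nonneg)
    then have "ennreal (innov_density a y) * ennreal (innov_ratio a \<Delta> y) \<le> ennreal (innov_density a (y - \<Delta>))"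
      using a by (simp add: ennreal_mult'[symmetric] innov_density_nonneg ennreal_leI)
    then have "(ennreal (innov_density a y) * ennreal (innov_ratio a \<Delta> y)) * g y \<le>
        ennreal (innov_density a (y - \<Delta>)) * g y"
      by (rule mult_right_mono) simp
    then show "ennreal (innov_density a y) * (g y * ennreal (innov_ratio a \<Delta> y)) \<le>
        ennreal (innov_density a (y - \<Delta>)) * g y"
      by (simp add: mult_ac)
  qed
  also have "\<dots> = (\<integral>\<^sup>+y. ennreal (innov_density a y) * g (\<Delta> + y) \<partial>lborel)"
    by (subst nn_integral_real_affine[of _ 1 \<Delta>]) auto
  also have "\<dots> = (\<integral>\<^sup>+y. g (\<Delta> + y) \<partial>innov_measure a)"
    by (rule nn_integral_innov_measure[OF a, symmetric]) measurable
  finally show ?thesis .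
qed

lemma nn_integral_sqrt_innov_ratio_ge:
  assumes a: "0 < a" "a < 2" and \<Delta>: "0 \<le> \<Delta>" "\<Delta> \<le> 1"
  shows "ennreal (1 - hellinger_const a * \<Delta> powr a) \<le>
    (\<integral>\<^sup>+y. ennreal (sqrt (innov_ratio a \<Delta> y)) \<partial>innov_measure a)"
proof -
  have "innov_density a y * sqrt (innov_ratio a \<Delta> y) =
      sqrt (innov_density a y * innov_density a (y - \<Delta>))" for y
  proof -
    have "sqrt (innov_density a y * innov_density a (y - \<Delta>)) =
        sqrt ((innov_density a y)\<^sup>2 * innov_ratio a \<Delta> y)"
      by (simp add: innov_ratio_def power2_eq_square)
    also have "\<dots> = innov_density a y * sqrt (innov_ratio a \<Delta> y)"
      using a by (simp add: real_sqrt_mult innov_density_nonneg)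
    finally show ?thesis
      by simp
  qed
  then have "(\<integral>\<^sup>+y. ennreal (sqrt (innov_ratio a \<Delta> y)) \<partial>innov_measure a) =
      (\<integral>\<^sup>+y. ennreal (sqrt (innov_density a y * innov_density a (y - \<Delta>))) \<partial>lborel)"
    using a by (subst nn_integral_innov_measure)
      (auto simp: ennreal_mult'[symmetric] innov_density_nonneg)
  moreover have "ennreal (1 - hellinger_const a * \<Delta> powr a) \<le>
      (\<integral>\<^sup>+y. ennreal (sqrt (innov_density a y * innov_density a (y - \<Delta>))) \<partial>lborel)"
  proof (cases "\<Delta> = 0")
    case True
    have "(\<integral>\<^sup>+y. ennreal (innov_density a y) \<partial>lborel) = emeasure (innov_measure a) UNIV"
      by (simp add: innov_measure_def emeasure_density)
    also have "\<dots> = 1"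
      using prob_space.emeasure_space_1[OF prob_space_innov_measure[OF a(1)]] by simp
    finally show ?thesis
      using True a by (simp add: innov_density_nonneg)
  qed (use hellinger_affinity_shift_ge[OF a] \<Delta> in auto)
  ultimately show ?thesis
    by simp
qed

section \<open>The finite autoregression and its likelihood ratio\<close>

primrec ar_path :: "real \<Rightarrow> (int \<Rightarrow> real) \<Rightarrow> (int \<Rightarrow> real) \<Rightarrow> nat \<Rightarrow> real" where
  "ar_path x b e 0 = x"
| "ar_path x b e (Suc n) = b (int n + 1) * ar_path x b e n + e (int n + 1)"

definition ar_obs :: "real \<Rightarrow> (int \<Rightarrow> real) \<Rightarrow> nat \<Rightarrow> (int \<Rightarrow> real) \<Rightarrow> int \<Rightarrow> real" where
  "ar_obs x b n e = (\<lambda>k\<in>{1..int n}. ar_path x b e (nat k))"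

definition past_value :: "real \<Rightarrow> (int \<Rightarrow> real) \<Rightarrow> nat \<Rightarrow> real" where
  "past_value x e k = (if k = 0 then x else e (int k))"

text \<open>A function of observed data, not of innovations: factor \<open>k\<close> compares the
  conditional law of observation \<open>k + 1\<close> under the bump, a translate by coefficient
  times preceding value, with the law under the zero coefficient.\<close>

definition lik_ratio :: "real \<Rightarrow> real \<Rightarrow> (int \<Rightarrow> real) \<Rightarrow> nat \<Rightarrow> (int \<Rightarrow> real) \<Rightarrow> real" where
  "lik_ratio a x b n e =
     (\<Prod>k<n. innov_ratio a (b (int k + 1) * past_value x e k) (e (int k + 1)))"

abbreviation innov_prod :: "real \<Rightarrow> nat \<Rightarrow> (int \<Rightarrow> real) measure" where
  "innov_prod a n \<equiv> Pi\<^sub>M {1..int n} (\<lambda>_. innov_measure a)"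

lemma lik_ratio_nonneg: "0 < a \<Longrightarrow> 0 \<le> lik_ratio a x b n e"
  by (simp add: lik_ratio_def prod_nonneg innov_ratio_nonneg)

lemma lik_ratio_Suc_upd:
  "lik_ratio a x b (Suc n) (e(int n + 1 := y)) =
     lik_ratio a x b n e * innov_ratio a (b (int n + 1) * past_value x e n) y"
proof -
  have "past_value x (e(int n + 1 := y)) k = past_value x e k" if "k \<le> n" for k
    using that by (auto simp: past_value_def)
  then show ?thesis
    by (simp add: lik_ratio_def)
qed

lemma ar_path_cong:
  "(\<And>k. 1 \<le> k \<Longrightarrow> k \<le> int n \<Longrightarrow> e k = e' k) \<Longrightarrow> ar_path x b e n = ar_path x b e' n"
  by (induction n) auto

lemma ar_obs_Suc_upd:
  "ar_obs x b (Suc n) (e(int n + 1 := y)) =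
     (ar_obs x b n e)(int n + 1 := b (int n + 1) * ar_path x b e n + y)"
proof
  fix k
  have "ar_path x b (e(int n + 1 := y)) m = ar_path x b e m" if "m \<le> n" for m
    using that by (intro ar_path_cong) auto
  moreover have "nat (int n + 1) = Suc n"
    by simp
  ultimately show "ar_obs x b (Suc n) (e(int n + 1 := y)) k =
      ((ar_obs x b n e)(int n + 1 := b (int n + 1) * ar_path x b e n + y)) k"
    by (auto simp: ar_obs_def)
qed

text \<open>On data generated by the autoregression, the shift in the likelihood ratio is the true
  one; this identity closes the induction for the change of measure.\<close>

lemma past_value_ar_obs: "past_value x (ar_obs x b n e) n = ar_path x b e n"
  by (simp add: past_value_def ar_obs_def)

lemma ar_path_measurable:
  assumes f[measurable]: "f \<in> borel_measurable M" and g: "g \<in> measurable M (innov_prod a n)"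
    and "m \<le> n"
  shows "(\<lambda>w. ar_path (f w) b (g w) m) \<in> borel_measurable M"
  using \<open>m \<le> n\<close>
proof (induction m)
  case (Suc m)
  then have [measurable]: "(\<lambda>w. ar_path (f w) b (g w) m) \<in> borel_measurable M"
    by simp
  have "(\<lambda>e. e (int m + 1)) \<in> measurable (innov_prod a n) (innov_measure a)"
    using Suc.prems by (intro measurable_component_singleton) auto
  from measurable_compose[OF g this]
  have [measurable]: "(\<lambda>w. g w (int m + 1)) \<in> borel_measurable M"
    by (simp add: measurable_cong_sets[OF refl sets_innov_measure])
  show ?case
    by simp
qed simp

lemma ar_obs_measurable [measurable (raw)]:
  assumes "f \<in> borel_measurable M" "g \<in> measurable M (innov_prod a n)"
  shows "(\<lambda>w. ar_obs (f w) b n (g w)) \<in> measurable M (innov_prod a n)"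
  unfolding ar_obs_def
  by (intro measurable_restrict)
    (auto intro!: ar_path_measurable assms simp: measurable_cong_sets[OF refl sets_innov_measure])

lemma past_value_measurable [measurable]:
  assumes "k \<le> n"
  shows "(\<lambda>e. past_value x e k) \<in> borel_measurable (innov_prod a n)"
proof (cases "k = 0")
  case False
  then have "(\<lambda>e. e (int k)) \<in> measurable (innov_prod a n) (innov_measure a)"
    using assms by (intro measurable_component_singleton) auto
  with False show ?thesis
    by (simp add: past_value_def measurable_cong_sets[OF refl sets_innov_measure])
qed (simp add: past_value_def)

lemma lik_ratio_measurable [measurable]: "lik_ratio a x b n \<in> borel_measurable (innov_prod a' n)"
  unfolding lik_ratio_def
proof (intro borel_measurable_prod innov_ratio_measurable)
  fix k assume k: "k \<in> {..<n}"
  then have [measurable]: "(\<lambda>e. past_value x e k) \<in> borel_measurable (innov_prod a' n)"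
    by (intro past_value_measurable) auto
  show "(\<lambda>e. b (int k + 1) * past_value x e k) \<in> borel_measurable (innov_prod a' n)"
    by measurable
  have "(\<lambda>e. e (int k + 1)) \<in> measurable (innov_prod a' n) (innov_measure a')"
    using k by (intro measurable_component_singleton) auto
  then show "(\<lambda>e. e (int k + 1)) \<in> borel_measurable (innov_prod a' n)"
    by (simp add: measurable_cong_sets[OF refl sets_innov_measure])
qed

section \<open>Integrating out the last innovation\<close>

lemma atLeastAtMost_int_Suc: "{1..int (Suc n)} = insert (int n + 1) {1..int n}"
  by auto

lemma nn_integral_innov_prod_Suc:
  assumes a: "0 < a" and f: "f \<in> borel_measurable (innov_prod a (Suc n))"
  shows "(\<integral>\<^sup>+e. f e \<partial>innov_prod a (Suc n)) =
    (\<integral>\<^sup>+e. \<integral>\<^sup>+y. f (e(int n + 1 := y)) \<partial>innov_measure a \<partial>innov_prod a n)"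
proof -
  interpret prob_space "innov_measure a"
    by (rule prob_space_innov_measure[OF a])
  interpret product_sigma_finite "\<lambda>_::int. innov_measure a"
    by (intro product_sigma_finite.intro sigma_finite_measure_axioms)
  show ?thesis
    unfolding atLeastAtMost_int_Suc
  proof (rule product_nn_integral_insert)
    show "f \<in> borel_measurable (Pi\<^sub>M (insert (int n + 1) {1..int n}) (\<lambda>_. innov_measure a))"
      using f by (simp only: atLeastAtMost_int_Suc)
  qed auto
qed

lemma innov_prod_upd_measurable:
  assumes "f \<in> borel_measurable (innov_prod a (Suc n))"
  shows "(\<lambda>(e, y). f (e(int n + 1 := y))) \<in>
    borel_measurable (innov_prod a n \<Otimes>\<^sub>M innov_measure a)"
proof -
  have "(\<lambda>(e, y). e(int n + 1 := y)) \<in>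
      measurable (innov_prod a n \<Otimes>\<^sub>M innov_measure a) (innov_prod a (Suc n))"
    unfolding atLeastAtMost_int_Suc by (rule measurable_add_dim)
  from measurable_compose[OF this assms] show ?thesis
    by (simp add: case_prod_beta)
qed

lemma innov_prod_upd_section_measurable:
  assumes f: "f \<in> borel_measurable (innov_prod a (Suc n))" and e: "e \<in> space (innov_prod a n)"
  shows "(\<lambda>y. f (e(int n + 1 := y))) \<in> borel_measurable (innov_measure a)"
  using measurable_compose[OF measurable_Pair1'[OF e] innov_prod_upd_measurable[OF f]]
  by (simp only: case_prod_conv)

lemma prob_space_innov_prod:
  assumes "0 < a"
  shows "prob_space (innov_prod a n)"
  by (rule prob_space_PiM) (rule prob_space_innov_measure[OF assms])

text \<open>Change of measure by induction: integrating the last coordinate against its ratio leaves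
  a functional of the first \<open>n\<close> coordinates, to which the hypothesis applies. This is
  why \<open>g\<close> has to be arbitrary.\<close>

lemma nn_integral_lik_ratio_le:
  assumes a: "0 < a" and "g \<in> borel_measurable (innov_prod a n)"
  shows "(\<integral>\<^sup>+e. g e * ennreal (lik_ratio a x b n e) \<partial>innov_prod a n) \<le>
    (\<integral>\<^sup>+e. g (ar_obs x b n e) \<partial>innov_prod a n)"
  using assms(2)
proof (induction n arbitrary: g)
  case 0
  have "ar_obs x b 0 e = e" if "e \<in> space (innov_prod a 0)" for e
    using that by (auto simp: ar_obs_def space_PiM_empty)
  then show ?case
    by (intro eq_refl nn_integral_cong) (simp add: lik_ratio_def)
next
  case (Suc n)
  interpret prob_space "innov_measure a"
    by (rule prob_space_innov_measure[OF a])
  have obs: "ar_obs x b m \<in> measurable (innov_prod a m) (innov_prod a m)" for m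
    by (rule ar_obs_measurable) auto
  note [measurable] = Suc.prems
  note [measurable] = innov_prod_upd_measurable[OF Suc.prems]
  define G where "G e = (\<integral>\<^sup>+y. g (e(int n + 1 := y)) *
      ennreal (innov_ratio a (b (int n + 1) * past_value x e n) y) \<partial>innov_measure a)" for e
  have [measurable]: "(\<lambda>e. past_value x e n) \<in> borel_measurable (innov_prod a n)"
    by (rule past_value_measurable) simp
  have G: "G \<in> borel_measurable (innov_prod a n)"
    unfolding G_def by measurable
  have "(\<integral>\<^sup>+e. g e * ennreal (lik_ratio a x b (Suc n) e) \<partial>innov_prod a (Suc n)) =
      (\<integral>\<^sup>+e. \<integral>\<^sup>+y. g (e(int n + 1 := y)) * ennreal (lik_ratio a x b (Suc n) (e(int n + 1 := y)))
        \<partial>innov_measure a \<partial>innov_prod a n)"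
    by (rule nn_integral_innov_prod_Suc[OF a]) measurable
  also have "\<dots> = (\<integral>\<^sup>+e. G e * ennreal (lik_ratio a x b n e) \<partial>innov_prod a n)"
  proof (rule nn_integral_cong)
    fix e assume e: "e \<in> space (innov_prod a n)"
    have [measurable]: "(\<lambda>y. g (e(int n + 1 := y))) \<in> borel_measurable (innov_measure a)"
      by (rule innov_prod_upd_section_measurable[OF Suc.prems e])
    show "(\<integral>\<^sup>+y. g (e(int n + 1 := y)) * ennreal (lik_ratio a x b (Suc n) (e(int n + 1 := y)))
        \<partial>innov_measure a) = G e * ennreal (lik_ratio a x b n e)"
      unfolding G_def lik_ratio_Suc_upd using a
      by (subst nn_integral_multc[symmetric])
        (auto simp: ennreal_mult lik_ratio_nonneg innov_ratio_nonneg mult_ac)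
  qed
  \<comment> \<open>First the initial data are replaced by the autoregressive ones; only then is the
    last ratio turned into a translation, now by the actual state of the path.\<close>
  also have "\<dots> \<le> (\<integral>\<^sup>+e. G (ar_obs x b n e) \<partial>innov_prod a n)"
    by (rule Suc.IH[OF G])
  also have "\<dots> \<le> (\<integral>\<^sup>+e. \<integral>\<^sup>+y. g (ar_obs x b (Suc n) (e(int n + 1 := y)))
      \<partial>innov_measure a \<partial>innov_prod a n)"
  proof (rule nn_integral_mono)
    fix e assume e: "e \<in> space (innov_prod a n)"
    then have e': "ar_obs x b n e \<in> space (innov_prod a n)"
      using measurable_space[OF obs] by blast
    have "(\<lambda>y. g ((ar_obs x b n e)(int n + 1 := y))) \<in> borel_measurable (innov_measure a)"
      by (rule innov_prod_upd_section_measurable[OF Suc.prems e'])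
    then have m: "(\<lambda>y. g ((ar_obs x b n e)(int n + 1 := y))) \<in> borel_measurable borel"
      by (simp add: measurable_cong_sets[OF sets_innov_measure refl])
    show "G (ar_obs x b n e) \<le>
        (\<integral>\<^sup>+y. g (ar_obs x b (Suc n) (e(int n + 1 := y))) \<partial>innov_measure a)"
      unfolding G_def past_value_ar_obs ar_obs_Suc_upd
      by (rule nn_integral_innov_ratio_le_shift[OF a m])
  qed
  also have "\<dots> = (\<integral>\<^sup>+e. g (ar_obs x b (Suc n) e) \<partial>innov_prod a (Suc n))"
    by (rule nn_integral_innov_prod_Suc[OF a, symmetric])
      (rule measurable_compose[OF obs Suc.prems])
  finally show ?case .
qed

text \<open>Given the earlier coordinates, the last factor has an affinity bounded below uniformly
  over all shifts in \<open>[0, b k * M]\<close>, so the bounds multiply although the shifts are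
  random. \<open>1 \<le> M\<close> lets \<open>M\<close> dominate the innovations as well as the
  start value.\<close>

lemma nn_integral_sqrt_lik_ratio_ge:
  assumes a: "0 < a" "a < 2" and x: "0 \<le> x" "x \<le> M" and M: "1 \<le> M"
    and b: "\<And>k. 0 \<le> b k" "\<And>k. b k * M \<le> 1"
    and small: "\<And>k. hellinger_const a * (b k * M) powr a \<le> 1"
  shows "ennreal (\<Prod>k<n. 1 - hellinger_const a * (b (int k + 1) * M) powr a) \<le>
    (\<integral>\<^sup>+e. ennreal (sqrt (lik_ratio a x b n e)) \<partial>innov_prod a n)"
proof (induction n)
  case 0
  show ?case
    using prob_space.emeasure_space_1[OF prob_space_innov_prod[OF a(1), of 0]]
    by (simp add: lik_ratio_def)
next
  case (Suc n)
  let ?t = "1 - hellinger_const a * (b (int n + 1) * M) powr a"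
  have "ennreal (\<Prod>k<Suc n. 1 - hellinger_const a * (b (int k + 1) * M) powr a) =
      ennreal (\<Prod>k<n. 1 - hellinger_const a * (b (int k + 1) * M) powr a) * ennreal ?t"
    \<comment> \<open>\<open>small\<close> keeps all factors nonnegative, as multiplicativity of
      \<open>ennreal\<close> requires.\<close>
    using small by (simp add: ennreal_mult prod_nonneg)
  also have "\<dots> \<le> (\<integral>\<^sup>+e. ennreal (sqrt (lik_ratio a x b n e)) \<partial>innov_prod a n) * ennreal ?t"
    by (intro mult_right_mono Suc.IH) simp
  also have "\<dots> = (\<integral>\<^sup>+e. ennreal (sqrt (lik_ratio a x b n e)) * ennreal ?t \<partial>innov_prod a n)"
    by (rule nn_integral_multc[symmetric]) measurable
  also have "\<dots> \<le> (\<integral>\<^sup>+e. \<integral>\<^sup>+y. ennreal (sqrt (lik_ratio a x b (Suc n) (e(int n + 1 := y))))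
      \<partial>innov_measure a \<partial>innov_prod a n)"
  proof (rule nn_integral_mono)
    fix e assume "e \<in> space (innov_prod a n)"
    let ?d = "b (int n + 1) * past_value x e n"
    have "(\<integral>\<^sup>+y. ennreal (sqrt (lik_ratio a x b (Suc n) (e(int n + 1 := y)))) \<partial>innov_measure a) =
        ennreal (sqrt (lik_ratio a x b n e)) * (\<integral>\<^sup>+y. ennreal (sqrt (innov_ratio a ?d y)) \<partial>innov_measure a)"
      unfolding lik_ratio_Suc_upd using a
      by (subst nn_integral_cmult[symmetric])
        (auto simp: real_sqrt_mult ennreal_mult lik_ratio_nonneg innov_ratio_nonneg)
    moreover have "ennreal (sqrt (lik_ratio a x b n e)) * ennreal ?t \<le>
        ennreal (sqrt (lik_ratio a x b n e)) * (\<integral>\<^sup>+y. ennreal (sqrt (innov_ratio a ?d y)) \<partial>innov_measure a)"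
    proof (cases "0 \<le> past_value x e n \<and> past_value x e n \<le> M")
      case True
      have d: "0 \<le> ?d" "?d \<le> b (int n + 1) * M"
        using True b by (auto intro: mult_left_mono)
      have "?t \<le> 1 - hellinger_const a * ?d powr a"
        using d a hellinger_const_pos[OF a] by (auto intro!: mult_left_mono powr_mono2)
      then have "ennreal ?t \<le> ennreal (1 - hellinger_const a * ?d powr a)"
        by (rule ennreal_leI)
      also have "\<dots> \<le> (\<integral>\<^sup>+y. ennreal (sqrt (innov_ratio a ?d y)) \<partial>innov_measure a)"
        using d b(2)[of "int n + 1"] by (intro nn_integral_sqrt_innov_ratio_ge a) auto
      finally show ?thesis
        by (rule mult_left_mono) simp
    next
      case False
      \<comment> \<open>The start value lies in \<open>[0, M]\<close>, so the offending value is an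
        earlier coordinate outside the support. It is the denominator's argument in the preceding
        ratio, which is therefore 0.\<close>
      then obtain m where m: "n = Suc m"
        using x by (cases n) (auto simp: past_value_def)
      with False M have "innov_density a (e (int m + 1)) = 0"
        by (auto simp: past_value_def innov_density_def add.commute)
      then have "lik_ratio a x b n e = 0"
        by (simp add: m lik_ratio_def innov_ratio_def)
      then show ?thesis
        by simp
    qed
    ultimately show "ennreal (sqrt (lik_ratio a x b n e)) * ennreal ?t \<le>
        (\<integral>\<^sup>+y. ennreal (sqrt (lik_ratio a x b (Suc n) (e(int n + 1 := y)))) \<partial>innov_measure a)"
      by simp
  qed
  also have "\<dots> = (\<integral>\<^sup>+e. ennreal (sqrt (lik_ratio a x b (Suc n) e)) \<partial>innov_prod a (Suc n))"
    by (rule nn_integral_innov_prod_Suc[OF a(1), symmetric]) measurable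
  finally show ?case .
qed

text \<open>
  Le Cam's two-point bound: the likelihood ratio \<open>R\<close> satisfies
  \<open>\<kappa> * sqrt R \<le> min 1 R + \<kappa>\<^sup>2/4 * (1 + R)\<close> and has mean at most \<open>1\<close>, so a mean of
  \<open>sqrt R\<close> of at least \<open>\<kappa>\<close> forces a mean of \<open>min 1 R\<close> of at least \<open>\<kappa>\<^sup>2/2\<close>.
\<close>

lemma two_point_testing_bound:
  assumes a: "0 < a" and A: "A \<in> sets (innov_prod a n)" and \<kappa>: "0 \<le> \<kappa>"
    and aff: "ennreal \<kappa> \<le> (\<integral>\<^sup>+e. ennreal (sqrt (lik_ratio a x b n e)) \<partial>innov_prod a n)"
  shows "ennreal (\<kappa>\<^sup>2 / 2) \<le>
    (\<integral>\<^sup>+e. indicator A e + indicator (- A) (ar_obs x b n e) \<partial>innov_prod a n)"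
proof -
  interpret P: prob_space "innov_prod a n"
    by (rule prob_space_innov_prod[OF a])
  let ?R = "lik_ratio a x b n"
  note [measurable] = A
  have [measurable]: "ar_obs x b n \<in> measurable (innov_prod a n) (innov_prod a n)"
    by (rule ar_obs_measurable) auto
  have R0: "0 \<le> ?R e" for e
    by (rule lik_ratio_nonneg[OF a])
  have R1: "(\<integral>\<^sup>+e. ennreal (?R e) \<partial>innov_prod a n) \<le> 1"
    using nn_integral_lik_ratio_le[OF a, of "\<lambda>_. 1" n x b] by (simp add: P.emeasure_space_1)
  let ?m = "\<integral>\<^sup>+e. ennreal (min 1 (?R e)) \<partial>innov_prod a n"
  have "ennreal (\<kappa> * \<kappa>) \<le> ennreal \<kappa> * (\<integral>\<^sup>+e. ennreal (sqrt (?R e)) \<partial>innov_prod a n)"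
    using \<kappa> by (simp add: ennreal_mult mult_left_mono aff)
  also have "\<dots> = (\<integral>\<^sup>+e. ennreal \<kappa> * ennreal (sqrt (?R e)) \<partial>innov_prod a n)"
    by (rule nn_integral_cmult[symmetric]) measurable
  also have "\<dots> \<le> (\<integral>\<^sup>+e. ennreal (min 1 (?R e)) + ennreal (\<kappa>\<^sup>2 / 4) * (1 + ennreal (?R e)) \<partial>innov_prod a n)"
  proof (rule nn_integral_mono)
    fix e
    define s where "s = sqrt (?R e)"
    have s: "0 \<le> s" "?R e = s\<^sup>2"
      using R0[of e] by (auto simp: s_def)
    have "\<kappa> * s \<le> min 1 (s\<^sup>2) + \<kappa>\<^sup>2 / 4 * (1 + s\<^sup>2)"
    proof -
      \<comment> \<open>Two completed squares, one for each value that the minimum can take.\<close>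
      have "0 \<le> (1 - \<kappa> / 2 * s)\<^sup>2" "0 \<le> (s - \<kappa> / 2)\<^sup>2" "0 \<le> \<kappa>\<^sup>2 / 4" "0 \<le> \<kappa>\<^sup>2 / 4 * s\<^sup>2"
        by simp_all
      then have "\<kappa> * s \<le> 1 + \<kappa>\<^sup>2 / 4 * s\<^sup>2" "\<kappa> * s \<le> s\<^sup>2 + \<kappa>\<^sup>2 / 4"
        by (simp_all add: power2_eq_square algebra_simps)
      moreover have "\<kappa>\<^sup>2 / 4 * (1 + s\<^sup>2) = \<kappa>\<^sup>2 / 4 + \<kappa>\<^sup>2 / 4 * s\<^sup>2"
        by (simp add: distrib_left)
      moreover have "min 1 (s\<^sup>2) = 1 \<or> min 1 (s\<^sup>2) = s\<^sup>2"
        by (simp add: min_def)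
      ultimately show ?thesis
        using \<open>0 \<le> \<kappa>\<^sup>2 / 4\<close> \<open>0 \<le> \<kappa>\<^sup>2 / 4 * s\<^sup>2\<close> by linarith
    qed
    then have "ennreal (\<kappa> * s) \<le> ennreal (min 1 (s\<^sup>2) + \<kappa>\<^sup>2 / 4 * (1 + s\<^sup>2))"
      by (rule ennreal_leI)
    then show "ennreal \<kappa> * ennreal (sqrt (?R e)) \<le>
        ennreal (min 1 (?R e)) + ennreal (\<kappa>\<^sup>2 / 4) * (1 + ennreal (?R e))"
      unfolding s_def[symmetric] s(2) using \<kappa> s(1)
      by (simp add: ennreal_mult[symmetric] flip: ennreal_plus ennreal_1)
  qed
  also have "\<dots> = ?m + ennreal (\<kappa>\<^sup>2 / 4) * (1 + (\<integral>\<^sup>+e. ennreal (?R e) \<partial>innov_prod a n))"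
    by (simp add: nn_integral_add nn_integral_cmult P.emeasure_space_1)
  also have "\<dots> \<le> ?m + ennreal (\<kappa>\<^sup>2 / 4) * (1 + 1)"
    by (intro add_left_mono mult_left_mono R1) simp
  also have "ennreal (\<kappa>\<^sup>2 / 4) * (1 + 1) = ennreal (\<kappa>\<^sup>2 / 2)"
    by (simp add: one_add_one flip: ennreal_numeral ennreal_mult)
  finally have *: "ennreal (\<kappa> * \<kappa>) \<le> ?m + ennreal (\<kappa>\<^sup>2 / 2)" .
  have "ennreal (\<kappa>\<^sup>2 / 2) \<le> ?m"
  \<comment> \<open>Cancelling \<kappa>^2/2 is legitimate only when the integral is finite; an
    infinite one is trivial.\<close>
  proof (cases ?m)
    case (real r)
    with * have "ennreal (\<kappa> * \<kappa>) \<le> ennreal (r + \<kappa>\<^sup>2 / 2)"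
      by (simp add: ennreal_plus)
    then have "\<kappa> * \<kappa> \<le> r + \<kappa>\<^sup>2 / 2"
      using real(1) by (subst (asm) ennreal_le_iff) auto
    then show ?thesis
      unfolding real(2) by (intro ennreal_leI) (simp add: power2_eq_square)
  qed simp
  \<comment> \<open>\<open>min 1 R\<close> is below the loss of every test, which is 1 on
    \<open>A\<close> and \<open>R\<close> off it.\<close>
  also have "?m \<le> (\<integral>\<^sup>+e. indicator A e + indicator (- A) e * ennreal (?R e) \<partial>innov_prod a n)"
    by (rule nn_integral_mono) (auto simp: indicator_def ennreal_le_1 intro: ennreal_leI)
  also have "\<dots> = (\<integral>\<^sup>+e. indicator A e \<partial>innov_prod a n) +
      (\<integral>\<^sup>+e. indicator (- A) e * ennreal (?R e) \<partial>innov_prod a n)"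
    by (rule nn_integral_add) measurable
  also have "\<dots> \<le> (\<integral>\<^sup>+e. indicator A e \<partial>innov_prod a n) +
      (\<integral>\<^sup>+e. indicator (- A) (ar_obs x b n e) \<partial>innov_prod a n)"
    by (intro add_left_mono nn_integral_lik_ratio_le a) measurable
  also have "\<dots> = (\<integral>\<^sup>+e. indicator A e + indicator (- A) (ar_obs x b n e) \<partial>innov_prod a n)"
    by (rule nn_integral_add[symmetric]) measurable
  finally show ?thesis .
qed

section \<open>The process and its past\<close>

context
  fixes f :: "real \<Rightarrow> real" and \<rho> :: real and N :: nat and \<epsilon> :: "int \<Rightarrow> real"
  assumes coeff: "\<And>u. 0 \<le> extend_coeff f u" "\<And>u. extend_coeff f u \<le> \<rho>" and \<rho>: "\<rho> < 1"
    and \<epsilon>: "\<And>k. 0 \<le> \<epsilon> k" "\<And>k. \<epsilon> k \<le> 1"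
begin

private lemma \<rho>_nonneg: "0 \<le> \<rho>"
  using coeff[of 0] by linarith

private lemma tvar_term_bounds:
  "0 \<le> (\<Prod>l<i. extend_coeff f (real_of_int (k - int l) / real N)) * \<epsilon> (k - int i)"
  "(\<Prod>l<i. extend_coeff f (real_of_int (k - int l) / real N)) * \<epsilon> (k - int i) \<le> \<rho> ^ i"
proof -
  let ?P = "\<Prod>l<i. extend_coeff f (real_of_int (k - int l) / real N)"
  have P: "0 \<le> ?P" "?P \<le> \<rho> ^ i"
    using prod_mono[of "{..<i}" "\<lambda>l. extend_coeff f (real_of_int (k - int l) / real N)" "\<lambda>_. \<rho>"]
    by (auto intro!: prod_nonneg coeff)
  show "0 \<le> ?P * \<epsilon> (k - int i)"
    using P \<epsilon> by simp
  have "?P * \<epsilon> (k - int i) \<le> ?P"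
    using P \<epsilon> by (intro mult_right_le_one_le) auto
  with P show "?P * \<epsilon> (k - int i) \<le> \<rho> ^ i"
    by linarith
qed

private lemma tvar_summable:
  "summable (\<lambda>i. (\<Prod>l<i. extend_coeff f (real_of_int (k - int l) / real N)) * \<epsilon> (k - int i))"
proof (rule summable_comparison_test')
  show "summable (\<lambda>i. \<rho> ^ i)"
    using \<rho> \<rho>_nonneg by (intro summable_geometric) simp
qed (use tvar_term_bounds in simp)

lemma tvar_process_bounds:
  "0 \<le> tvar_process f N k \<epsilon>" "tvar_process f N k \<epsilon> \<le> 1 / (1 - \<rho>)"
proof -
  show "0 \<le> tvar_process f N k \<epsilon>"
    unfolding tvar_process_def by (rule suminf_nonneg[OF tvar_summable tvar_term_bounds(1)])
  have "tvar_process f N k \<epsilon> \<le> (\<Sum>i. \<rho> ^ i)"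
    unfolding tvar_process_def using \<rho> \<rho>_nonneg
    by (intro suminf_le tvar_term_bounds tvar_summable summable_geometric) auto
  then show "tvar_process f N k \<epsilon> \<le> 1 / (1 - \<rho>)"
    using \<rho> \<rho>_nonneg by (simp add: suminf_geometric)
qed

lemma tvar_process_rec:
  "tvar_process f N k \<epsilon> =
     extend_coeff f (real_of_int k / real N) * tvar_process f N (k - 1) \<epsilon> + \<epsilon> k"
proof -
  have "tvar_process f N k \<epsilon> =
      (\<Sum>i. (\<Prod>l<Suc i. extend_coeff f (real_of_int (k - int l) / real N)) * \<epsilon> (k - int (Suc i))) + \<epsilon> k"
    unfolding tvar_process_def by (subst suminf_split_head[OF tvar_summable]) simp
  also have "(\<lambda>i. (\<Prod>l<Suc i. extend_coeff f (real_of_int (k - int l) / real N)) * \<epsilon> (k - int (Suc i))) =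
      (\<lambda>i. extend_coeff f (real_of_int k / real N) *
        ((\<Prod>l<i. extend_coeff f (real_of_int (k - 1 - int l) / real N)) * \<epsilon> (k - 1 - int i)))"
    by (subst prod.lessThan_Suc_shift) (simp add: algebra_simps)
  also have "suminf \<dots> = extend_coeff f (real_of_int k / real N) * tvar_process f N (k - 1) \<epsilon>"
    unfolding tvar_process_def by (rule suminf_mult[OF tvar_summable])
  finally show ?thesis .
qed

text \<open>The infinite past enters only through the value at time 0; fixing that value leaves a
  function of finitely many innovations.\<close>

lemma observations_eq_ar_obs:
  "observations f N \<epsilon> =
     ar_obs (tvar_process f N 0 \<epsilon>) (\<lambda>k. extend_coeff f (real_of_int k / real N)) N (restrict \<epsilon> {1..int N})"
proof -
  have "tvar_process f N (int k) \<epsilon> =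
      ar_path (tvar_process f N 0 \<epsilon>) (\<lambda>k. extend_coeff f (real_of_int k / real N)) (restrict \<epsilon> {1..int N}) k"
    if "k \<le> N" for k
    using that
  proof (induction k)
    case (Suc k)
    have "tvar_process f N (int (Suc k)) \<epsilon> =
        extend_coeff f (real_of_int (int k + 1) / real N) * tvar_process f N (int k) \<epsilon> + \<epsilon> (int k + 1)"
      using tvar_process_rec[of "int k + 1"] by (simp add: add.commute)
    with Suc show ?case
      by simp
  qed simp
  note * = this
  have "tvar_process f N k \<epsilon> =
      ar_path (tvar_process f N 0 \<epsilon>) (\<lambda>k. extend_coeff f (real_of_int k / real N)) (restrict \<epsilon> {1..int N}) (nat k)"
    if "k \<in> {1..int N}" for k
    using *[of "nat k"] that by (simp add: nat_le_iff)
  then show ?thesis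
    unfolding observations_def ar_obs_def by (rule restrict_ext)
qed

end

text \<open>Only the term \<open>i = 0\<close> survives, because its product is empty and equals
  1.\<close>

lemma tvar_process_0: "tvar_process (\<lambda>_. 0) N k \<epsilon> = \<epsilon> k"
proof -
  have "tvar_process (\<lambda>_. 0) N k \<epsilon> = (\<Sum>i\<in>{0}. (\<Prod>l<i. 0) * \<epsilon> (k - int i))"
    unfolding tvar_process_def extend_coeff_def by (subst suminf_finite[of "{0}"]) auto
  then show ?thesis
    by simp
qed

text \<open>The process is causal, so the start value can be computed from the past block of
  coordinates alone.\<close>

lemma tvar_process_restrict: "tvar_process f N k (restrict \<epsilon> {..k}) = tvar_process f N k \<epsilon>"
  unfolding tvar_process_def by simp

section \<open>Independence of past and future innovations\<close>

abbreviation innov_space :: "real \<Rightarrow> (int \<Rightarrow> real) measure" where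
  "innov_space a \<equiv> innovation_space (innov_measure a)"

lemma prob_space_innov_space: "0 < a \<Longrightarrow> prob_space (innov_space a)"
  unfolding innovation_space_def by (intro prob_space_PiM prob_space_innov_measure)

lemma measurable_innov_component:
  assumes "k \<in> I"
  shows "(\<lambda>e. e k) \<in> borel_measurable (Pi\<^sub>M I (\<lambda>_. innov_measure a))"
  using measurable_component_singleton[OF assms, of "\<lambda>_. innov_measure a"]
  by (simp add: measurable_cong_sets[OF refl sets_innov_measure])

lemma tvar_process_measurable:
  assumes "{..k} \<subseteq> I"
  shows "tvar_process f N k \<in> borel_measurable (Pi\<^sub>M I (\<lambda>_. innov_measure a))"
proof -
  have [measurable]: "(\<lambda>e. e (k - int i)) \<in> borel_measurable (Pi\<^sub>M I (\<lambda>_. innov_measure a))" for i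
    using assms by (intro measurable_innov_component) auto
  show ?thesis
    unfolding tvar_process_def by measurable
qed

lemma observations_measurable:
  "observations f N \<in> measurable (innov_space a) (innov_prod a N)"
  unfolding observations_def innovation_space_def
  by (intro measurable_restrict)
    (auto intro!: tvar_process_measurable simp: measurable_cong_sets[OF refl sets_innov_measure])

lemma AE_innov_space:
  assumes "0 < a"
  shows "AE \<epsilon> in innov_space a. \<forall>k. 0 \<le> \<epsilon> k \<and> \<epsilon> k \<le> 1"
  unfolding AE_all_countable innovation_space_def
  by (intro allI AE_PiM_component prob_space_innov_measure assms AE_innov_measure) auto

abbreviation innov_past :: "real \<Rightarrow> (int \<Rightarrow> real) measure" where
  "innov_past a \<equiv> distr (innov_space a) (Pi\<^sub>M {..0} (\<lambda>_. innov_measure a)) (\<lambda>\<epsilon>. restrict \<epsilon> {..0})"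

text \<open>The coordinates of the product space are independent, and the two restrictions use
  disjoint blocks of them.\<close>

lemma distr_past_future:
  assumes a: "0 < a"
  shows "distr (innov_space a) (Pi\<^sub>M {..0} (\<lambda>_. innov_measure a) \<Otimes>\<^sub>M innov_prod a N)
      (\<lambda>\<epsilon>. (restrict \<epsilon> {..0}, restrict \<epsilon> {1..int N})) = innov_past a \<Otimes>\<^sub>M innov_prod a N"
proof -
  let ?M = "\<lambda>_::int. innov_measure a"
  interpret \<Omega>: prob_space "Pi\<^sub>M UNIV ?M"
    using prob_space_innov_space[OF a] by (simp add: innovation_space_def)
  interpret product_prob_space ?M UNIV
    by (intro product_prob_spaceI prob_space_innov_measure a)
  have "\<Omega>.indep_vars ?M (\<lambda>i \<epsilon>. \<epsilon> i) UNIV"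
  proof (subst \<Omega>.indep_vars_iff_distr_eq_PiM')
    show "distr (Pi\<^sub>M UNIV ?M) (Pi\<^sub>M UNIV ?M) (\<lambda>\<epsilon>. \<lambda>i\<in>UNIV. \<epsilon> i) =
        Pi\<^sub>M UNIV (\<lambda>i. distr (Pi\<^sub>M UNIV ?M) (innov_measure a) (\<lambda>\<epsilon>. \<epsilon> i))"
    proof -
      have "distr (Pi\<^sub>M UNIV ?M) (innov_measure a) (\<lambda>\<epsilon>. \<epsilon> i) = innov_measure a" for i
        using distr_PiM_component[of UNIV ?M i] by (simp add: prob_space_innov_measure a)
      moreover have "distr (Pi\<^sub>M UNIV ?M) (Pi\<^sub>M UNIV ?M) (\<lambda>\<epsilon>. \<lambda>i\<in>UNIV. \<epsilon> i) = Pi\<^sub>M UNIV ?M"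
        by (subst restrict_UNIV) (rule distr_id2, rule refl)
      ultimately show ?thesis
        by simp
    qed
  qed auto
  then have "\<Omega>.indep_var (Pi\<^sub>M {..0} ?M) (\<lambda>\<epsilon>. restrict \<epsilon> {..0})
      (innov_prod a N) (\<lambda>\<epsilon>. restrict \<epsilon> {1..int N})"
    using \<Omega>.indep_var_restrict[of ?M "\<lambda>i \<epsilon>. \<epsilon> i" UNIV "{..0}" "{1..int N}"] by auto
  then have "distr (Pi\<^sub>M UNIV ?M) (Pi\<^sub>M {..0} ?M \<Otimes>\<^sub>M innov_prod a N)
      (\<lambda>\<epsilon>. (restrict \<epsilon> {..0}, restrict \<epsilon> {1..int N})) =
    distr (Pi\<^sub>M UNIV ?M) (Pi\<^sub>M {..0} ?M) (\<lambda>\<epsilon>. restrict \<epsilon> {..0}) \<Otimes>\<^sub>M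
      distr (Pi\<^sub>M UNIV ?M) (innov_prod a N) (\<lambda>\<epsilon>. restrict \<epsilon> {1..int N})"
    by (simp add: \<Omega>.indep_var_distribution_eq)
  moreover have "distr (Pi\<^sub>M UNIV ?M) (innov_prod a N) (\<lambda>\<epsilon>. restrict \<epsilon> {1..int N}) = innov_prod a N"
    by (rule distr_PiM_restrict_finite) auto
  ultimately show ?thesis
    by (simp add: innovation_space_def)
qed

text \<open>Freezing the past reduces the claim to the finite testing problem with a fixed start
  value. That bound is the same for every start value in \<open>[0, M]\<close>, hence it survives
  integration over the past.\<close>

lemma two_point_process_bound:
  fixes f :: "real \<Rightarrow> real" and a \<rho> \<kappa> :: real and N :: nat
  defines "M \<equiv> 1 / (1 - \<rho>)" and "b \<equiv> \<lambda>k::int. extend_coeff f (real_of_int k / real N)"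
  assumes a: "0 < a" "a < 2" and coeff: "\<And>u. 0 \<le> extend_coeff f u" "\<And>u. extend_coeff f u \<le> \<rho>"
    and \<rho>: "\<rho> < 1" and bM: "\<And>k. b k * M \<le> 1" "\<And>k. hellinger_const a * (b k * M) powr a \<le> 1"
    and \<kappa>: "0 \<le> \<kappa>" "\<kappa> \<le> (\<Prod>k<N. 1 - hellinger_const a * (b (int k + 1) * M) powr a)"
    and A: "A \<in> sets (innov_prod a N)"
  shows "ennreal (\<kappa>\<^sup>2 / 2) \<le>
    emeasure (innov_space a) {\<epsilon> \<in> space (innov_space a). observations (\<lambda>_. 0) N \<epsilon> \<in> A} +
    emeasure (innov_space a) {\<epsilon> \<in> space (innov_space a). observations f N \<epsilon> \<notin> A}"
proof -
  interpret \<Omega>: prob_space "innov_space a"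
    by (rule prob_space_innov_space[OF a(1)])
  interpret P: prob_space "innov_prod a N"
    by (rule prob_space_innov_prod[OF a(1)])
  let ?past = "Pi\<^sub>M {..0} (\<lambda>_. innov_measure a)"
  have [measurable]: "tvar_process f N 0 \<in> borel_measurable ?past"
    by (rule tvar_process_measurable) simp
  have [measurable]: "(\<lambda>\<epsilon>. restrict \<epsilon> {..0}) \<in> measurable (innov_space a) ?past"
    unfolding innovation_space_def by (rule measurable_restrict_subset) simp
  have [measurable]: "(\<lambda>\<epsilon>. restrict \<epsilon> {1..int N}) \<in> measurable (innov_space a) (innov_prod a N)"
    unfolding innovation_space_def by (rule measurable_restrict_subset) simp
  interpret Past: prob_space "innov_past a"
    by (rule \<Omega>.prob_space_distr) measurable
  note [measurable] = A observations_measurable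
  \<comment> \<open>The two error indicators as a function of past \<open>p\<close> and future
    \<open>e\<close>: the zero coefficient yields \<open>e\<close> itself, the other one the path
    started at the value determined by \<open>p\<close>.\<close>
  define H :: "(int \<Rightarrow> real) \<times> (int \<Rightarrow> real) \<Rightarrow> ennreal" where
    "H = (\<lambda>(p, e). indicator A e + indicator (- A) (ar_obs (tvar_process f N 0 p) b N e))"
  have [measurable]: "H \<in> borel_measurable (?past \<Otimes>\<^sub>M innov_prod a N)"
    unfolding H_def by measurable
  have \<rho>0: "0 \<le> \<rho>"
    using coeff[of 0] by linarith
  have "ennreal (\<kappa>\<^sup>2 / 2) = (\<integral>\<^sup>+p. ennreal (\<kappa>\<^sup>2 / 2) \<partial>innov_past a)"
    by (subst nn_integral_const) (simp only: Past.emeasure_space_1 mult_1_right)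
  also have "\<dots> \<le> (\<integral>\<^sup>+p. \<integral>\<^sup>+e. H (p, e) \<partial>innov_prod a N \<partial>innov_past a)"
  proof (rule nn_integral_mono_AE)
    have "AE \<epsilon> in innov_space a. 0 \<le> tvar_process f N 0 (restrict \<epsilon> {..0}) \<and>
        tvar_process f N 0 (restrict \<epsilon> {..0}) \<le> M"
      using AE_innov_space[OF a(1)]
    proof eventually_elim
      case (elim \<epsilon>)
      then show ?case
        unfolding M_def tvar_process_restrict
        by (intro conjI tvar_process_bounds[OF coeff \<rho>]) auto
    qed
    then have "AE p in innov_past a. 0 \<le> tvar_process f N 0 p \<and> tvar_process f N 0 p \<le> M"
      by (subst AE_distr_iff) auto
    then show "AE p in innov_past a.
        ennreal (\<kappa>\<^sup>2 / 2) \<le> (\<integral>\<^sup>+e. H (p, e) \<partial>innov_prod a N)"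
    proof eventually_elim
      case (elim p)
      have "ennreal \<kappa> \<le> ennreal (\<Prod>k<N. 1 - hellinger_const a * (b (int k + 1) * M) powr a)"
        by (rule ennreal_leI[OF \<kappa>(2)])
      also have "\<dots> \<le> (\<integral>\<^sup>+e. ennreal (sqrt (lik_ratio a (tvar_process f N 0 p) b N e)) \<partial>innov_prod a N)"
        by (rule nn_integral_sqrt_lik_ratio_ge)
          (use a elim \<rho> \<rho>0 bM coeff in \<open>auto simp: M_def b_def\<close>)
      finally show ?case
        unfolding H_def case_prod_conv by (rule two_point_testing_bound[OF a(1) A \<kappa>(1)])
    qed
  qed
  also have "\<dots> = (\<integral>\<^sup>+w. H w \<partial>(innov_past a \<Otimes>\<^sub>M innov_prod a N))"
    by (rule P.nn_integral_fst) measurable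
  also have "\<dots> = (\<integral>\<^sup>+w. H w \<partial>distr (innov_space a) (?past \<Otimes>\<^sub>M innov_prod a N)
      (\<lambda>\<epsilon>. (restrict \<epsilon> {..0}, restrict \<epsilon> {1..int N})))"
    by (simp only: distr_past_future[OF a(1)])
  also have "\<dots> = (\<integral>\<^sup>+\<epsilon>. H (restrict \<epsilon> {..0}, restrict \<epsilon> {1..int N}) \<partial>innov_space a)"
    by (rule nn_integral_distr) measurable
  also have "\<dots> = (\<integral>\<^sup>+\<epsilon>. indicator {\<epsilon> \<in> space (innov_space a). observations (\<lambda>_. 0) N \<epsilon> \<in> A} \<epsilon> +
      indicator {\<epsilon> \<in> space (innov_space a). observations f N \<epsilon> \<notin> A} \<epsilon> \<partial>innov_space a)"
  proof (rule nn_integral_cong_AE)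
    show "AE \<epsilon> in innov_space a. H (restrict \<epsilon> {..0}, restrict \<epsilon> {1..int N}) =
        indicator {\<epsilon> \<in> space (innov_space a). observations (\<lambda>_. 0) N \<epsilon> \<in> A} \<epsilon> +
        indicator {\<epsilon> \<in> space (innov_space a). observations f N \<epsilon> \<notin> A} \<epsilon>"
      using AE_innov_space[OF a(1)] AE_space
    proof eventually_elim
      case (elim \<epsilon>)
      have "observations f N \<epsilon> = ar_obs (tvar_process f N 0 \<epsilon>) b N (restrict \<epsilon> {1..int N})"
        unfolding b_def by (rule observations_eq_ar_obs[OF coeff \<rho>]) (use elim in auto)
      moreover have "observations (\<lambda>_. 0) N \<epsilon> = restrict \<epsilon> {1..int N}"
        by (simp add: observations_def tvar_process_0)
      ultimately show ?case
        using elim by (simp add: H_def indicator_def tvar_process_restrict)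
    qed
  qed
  also have "\<dots> = (\<integral>\<^sup>+\<epsilon>. indicator {\<epsilon> \<in> space (innov_space a). observations (\<lambda>_. 0) N \<epsilon> \<in> A} \<epsilon> \<partial>innov_space a) +
      (\<integral>\<^sup>+\<epsilon>. indicator {\<epsilon> \<in> space (innov_space a). observations f N \<epsilon> \<notin> A} \<epsilon> \<partial>innov_space a)"
    by (rule nn_integral_add) measurable
  also have "\<dots> = emeasure (innov_space a) {\<epsilon> \<in> space (innov_space a). observations (\<lambda>_. 0) N \<epsilon> \<in> A} +
      emeasure (innov_space a) {\<epsilon> \<in> space (innov_space a). observations f N \<epsilon> \<notin> A}"
    by (intro arg_cong2[where f = "(+)"] nn_integral_indicator) measurable
  finally show ?thesis .
qed

section \<open>Bump functions\<close>

text \<open>This family is closed under differentiation, each derivative costing one power of the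
  truncated factor. A bump with finitely many explicit bounded derivatives is all that a given
  \<beta> demands.\<close>

definition poly_bump :: "real poly \<Rightarrow> nat \<Rightarrow> real \<Rightarrow> real" where
  "poly_bump p k u = poly p u * max 0 (1 - u\<^sup>2) ^ k"

lemma has_real_derivative_max_0_power:
  "((\<lambda>v::real. max 0 v ^ (k + 2)) has_real_derivative real (k + 2) * max 0 v ^ (k + 1)) (at v)"
proof (cases v "0::real" rule: linorder_cases)
  case less
  have "((\<lambda>v::real. max 0 v ^ (k + 2)) has_real_derivative 0) (at v)"
  proof (rule has_field_derivative_transform_within_open)
    show "((\<lambda>_. 0) has_real_derivative 0) (at v)"
      by (rule DERIV_const)
    show "v \<in> {..<0}"
      using less by simp
    show "0 = max 0 x ^ (k + 2)" if "x \<in> {..<0}" for x :: real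
      using that by (simp add: max_def)
  qed simp
  with less show ?thesis
    by simp
next
  case greater
  have "((\<lambda>v::real. max 0 v ^ (k + 2)) has_real_derivative real (k + 2) * v ^ (k + 1)) (at v)"
  proof (rule has_field_derivative_transform_within_open)
    show "((\<lambda>v::real. v ^ (k + 2)) has_real_derivative real (k + 2) * v ^ (k + 1)) (at v)"
      using DERIV_pow[of "k + 2" v UNIV] by simp
    show "v \<in> {0<..}"
      using greater by simp
    show "x ^ (k + 2) = max 0 x ^ (k + 2)" if "x \<in> {0<..}" for x :: real
      using that by (simp add: max_def)
  qed simp
  with greater show ?thesis
    by simp
next
  case equal
  \<comment> \<open>At the kink the difference quotient is itself a truncated power, with exponent
    at least 1, so it tends to 0.\<close>
  have "((\<lambda>h::real. max 0 h ^ (k + 1)) \<longlongrightarrow> max 0 0 ^ (k + 1)) (at 0)"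
    by (intro tendsto_intros)
  moreover have "\<forall>\<^sub>F h::real in at 0. max 0 h ^ (k + 1) = (max 0 (0 + h) ^ (k + 2) - max 0 0 ^ (k + 2)) / h"
    unfolding eventually_at_filter by (intro always_eventually) (auto simp: max_def)
  ultimately have "((\<lambda>h::real. (max 0 (0 + h) ^ (k + 2) - max 0 0 ^ (k + 2)) / h) \<longlongrightarrow> max 0 0 ^ (k + 1)) (at 0)"
    by (rule Lim_transform_eventually)
  then show ?thesis
    using equal by (simp add: DERIV_def)
qed

lemma has_real_derivative_poly_bump:
  "(poly_bump p (k + 2) has_real_derivative
     poly_bump (pderiv p * [:1, 0, -1:] - smult (2 * real (k + 2)) (pCons 0 p)) (k + 1) u) (at u)"
proof -
  have "((\<lambda>u::real. 1 - u\<^sup>2) has_real_derivative - (2 * u)) (at u)"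
    by (auto intro!: derivative_eq_intros)
  from DERIV_chain2[OF has_real_derivative_max_0_power this]
  have "((\<lambda>u. poly p u * max 0 (1 - u\<^sup>2) ^ (k + 2)) has_real_derivative
      poly (pderiv p) u * max 0 (1 - u\<^sup>2) ^ (k + 2) +
      real (k + 2) * max 0 (1 - u\<^sup>2) ^ (k + 1) * - (2 * u) * poly p u) (at u)"
    by (rule DERIV_mult[OF poly_DERIV])
  \<comment> \<open>Also valid where \<open>1 - u^2\<close> is negative: the remaining power is
    positive, so both sides are 0.\<close>
  moreover have "max 0 (1 - u\<^sup>2) ^ (k + 2) = (1 - u\<^sup>2) * max 0 (1 - u\<^sup>2) ^ (k + 1)"
    by (simp add: max_def)
  moreover have "poly (pderiv p * [:1, 0, -1:] - smult (2 * real (k + 2)) (pCons 0 p)) u =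
      poly (pderiv p) u * (1 - u\<^sup>2) - 2 * real (k + 2) * u * poly p u"
    by (simp add: power2_eq_square algebra_simps)
  moreover have "P * (V * W) + c * W * - (2 * u) * q = (P * V - 2 * c * u * q) * W" for P V W c q :: real
    by (simp add: algebra_simps)
  ultimately show ?thesis
    unfolding poly_bump_def[abs_def] by (simp only:)
qed

text \<open>Compactness bounds the function on [-1,1]; outside, the positive power of a vanishing
  factor suppresses the growth of the polynomial.\<close>

lemma poly_bump_bounded:
  assumes "0 < k"
  shows "\<exists>C>0. \<forall>u. \<bar>poly_bump p k u\<bar> \<le> C"
proof -
  have "continuous_on {-1..1} (poly_bump p k)"
    unfolding poly_bump_def by (intro continuous_intros)
  then have "bounded (poly_bump p k ` {-1..1})"
    by (intro compact_imp_bounded compact_continuous_image) auto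
  then obtain C where C: "0 < C" "\<And>u. u \<in> {-1..1} \<Longrightarrow> \<bar>poly_bump p k u\<bar> \<le> C"
    unfolding bounded_pos by auto
  show ?thesis
  proof (rule exI[of _ C], rule conjI[OF C(1)], rule allI)
    fix u :: real
    show "\<bar>poly_bump p k u\<bar> \<le> C"
    proof (cases "u \<in> {-1..1}")
      case False
      then have "1 \<le> \<bar>u\<bar>"
        by auto
      then have "1 \<le> u\<^sup>2"
        using abs_le_square_iff[of 1 u] by simp
      with assms C(1) show ?thesis
        by (simp add: poly_bump_def zero_power)
    qed (use C in auto)
  qed
qed

lemma strict_floor_bounds:
  assumes "0 < \<beta>"
  shows "real (strict_floor \<beta>) < \<beta>" "\<beta> \<le> real (strict_floor \<beta>) + 1"
proof -
  obtain m where m: "\<beta> \<le> real m"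
    using real_arch_simple by blast
  define n where "n = (LEAST m. \<beta> \<le> real m)"
  have n: "\<beta> \<le> real n" "\<And>k. k < n \<Longrightarrow> real k < \<beta>"
    unfolding n_def using LeastI[of "\<lambda>m. \<beta> \<le> real m", OF m]
      not_less_Least[of _ "\<lambda>m. \<beta> \<le> real m"] by (simp, simp add: not_le)
  with assms obtain k where k: "n = Suc k"
    by (cases n) auto
  have "strict_floor \<beta> = k"
    using n k by (intro strict_floor_eqI) auto
  with n k show "real (strict_floor \<beta>) < \<beta>" "\<beta> \<le> real (strict_floor \<beta>) + 1"
    by auto
qed

text \<open>Up to distance 1 the mean value bound is stronger than the power bound; beyond it the
  power is at least 1 and the sup bound suffices.\<close>

lemma hoelder_of_bounded_derivative:
  fixes f f' :: "real \<Rightarrow> real"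
  assumes "\<And>u. \<bar>f u\<bar> \<le> C" "\<And>u. (f has_real_derivative f' u) (at u)" "\<And>u. \<bar>f' u\<bar> \<le> C"
    and \<gamma>: "0 \<le> \<gamma>" "\<gamma> \<le> 1"
  shows "\<bar>f y - f z\<bar> \<le> 2 * C * \<bar>y - z\<bar> powr \<gamma>"
proof -
  have C: "0 \<le> C"
    using assms(1)[of 0] by linarith
  show ?thesis
  proof (cases "\<bar>y - z\<bar> \<le> 1")
    case True
    have "\<bar>f y - f z\<bar> \<le> C * \<bar>y - z\<bar>"
      using field_differentiable_bound[of UNIV f f' C y z] assms by simp
    also have "\<dots> \<le> C * \<bar>y - z\<bar> powr \<gamma>"
      using powr_mono'[of \<gamma> 1 "\<bar>y - z\<bar>"] \<gamma> True C by (intro mult_left_mono) auto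
    also have "\<dots> \<le> 2 * C * \<bar>y - z\<bar> powr \<gamma>"
      using C by (intro mult_right_mono) auto
    finally show ?thesis .
  next
    case False
    have "\<bar>f y - f z\<bar> \<le> 2 * C * 1"
      using assms(1)[of y] assms(1)[of z] by linarith
    also have "\<dots> \<le> 2 * C * \<bar>y - z\<bar> powr \<gamma>"
      using False C \<gamma> by (intro mult_left_mono ge_one_powr_ge_zero) auto
    finally show ?thesis .
  qed
qed

text \<open>The polynomial factor of the j-th derivative of \<open>max 0 (1 - u^2) ^ K\<close> for
  \<open>j < K\<close>; \<open>K - j\<close> is the exponent that the next differentiation brings
  down.\<close>

primrec bump_poly :: "nat \<Rightarrow> nat \<Rightarrow> real poly" where
  "bump_poly K 0 = 1"
| "bump_poly K (Suc j) =
     pderiv (bump_poly K j) * [:1, 0, -1:] - smult (2 * real (K - j)) (pCons 0 (bump_poly K j))"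

text \<open>The scaling \<open>h powr \<beta> * \<psi> ((u - x) / h)\<close> preserves the Hoelder
  seminorm of order \<beta>: all powers of \<open>h\<close> cancel, so \<open>A\<close> depends
  neither on \<open>h\<close> nor on the centre.\<close>

lemma hoelder_class_bump:
  assumes \<beta>: "0 < \<beta>" and L: "0 < L"
  obtains A \<psi> where "0 < A" "\<And>u. 0 \<le> \<psi> u" "\<And>u. \<psi> u \<le> 1" "\<psi> 0 = (1::real)"
    "\<And>u::real. 1 \<le> \<bar>u\<bar> \<Longrightarrow> \<psi> u = 0"
    "\<And>x h D. 0 < h \<Longrightarrow> (\<lambda>u. A * h powr \<beta> * \<psi> ((u - x) / h)) \<in> hoelder_class D L \<beta>"
proof -
  define m where "m = strict_floor \<beta>"
  define \<gamma> where "\<gamma> = \<beta> - real m"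
  have \<gamma>: "0 < \<gamma>" "\<gamma> \<le> 1"
    using strict_floor_bounds[OF \<beta>] by (auto simp: m_def \<gamma>_def)
  \<comment> \<open>The exponent \<open>m + 2\<close> leaves a positive power after
    \<open>m + 1\<close> derivatives, so derivative \<open>m\<close> is bounded with a bounded
    derivative.\<close>
  define d where "d j = poly_bump (bump_poly (m + 2) j) (m + 2 - j)" for j
  have deriv: "(d j has_real_derivative d (Suc j) u) (at u)" if "j \<le> m" for j u
    using has_real_derivative_poly_bump[of "bump_poly (m + 2) j" "m - j" u] that
    by (simp add: d_def Suc_diff_le)
  obtain C1 where C1: "0 < C1" "\<And>u. \<bar>d m u\<bar> \<le> C1"
    using poly_bump_bounded[of "m + 2 - m" "bump_poly (m + 2) m"] unfolding d_def by auto
  obtain C2 where C2: "0 < C2" "\<And>u. \<bar>d (Suc m) u\<bar> \<le> C2"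
    using poly_bump_bounded[of "m + 2 - Suc m" "bump_poly (m + 2) (Suc m)"] unfolding d_def by auto
  define C where "C = max C1 C2"
  have hoelder: "\<bar>d m y - d m z\<bar> \<le> 2 * C * \<bar>y - z\<bar> powr \<gamma>" for y z
    using C1 C2 deriv[of m] \<gamma>
    by (intro hoelder_of_bounded_derivative[where f' = "d (Suc m)"]) (auto simp: C_def le_max_iff_disj)
  define A where "A = L / (2 * C)"
  have C: "0 < C" and A: "0 < A"
    using L C1 by (auto simp: A_def C_def less_max_iff_disj)
  have d0: "d 0 u = max 0 (1 - u\<^sup>2) ^ (m + 2)" for u
    by (simp add: d_def poly_bump_def)
  show thesis
  proof (rule that[OF A, of "d 0"])
    show "0 \<le> d 0 u" for u
      by (simp add: d0)
    show "d 0 u \<le> 1" for u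
      unfolding d0 by (rule power_le_one) auto
    show "d 0 0 = 1"
      by (simp add: d0)
    show "d 0 u = 0" if "1 \<le> \<bar>u\<bar>" for u
    proof -
      have "1 \<le> u\<^sup>2"
        using that abs_le_square_iff[of 1 u] by simp
      then show ?thesis
        by (simp add: d0)
    qed
    fix x h :: real and D :: "real set"
    assume h: "0 < h"
    \<comment> \<open>The j-th derivative of the rescaled bump; each differentiation contributes a
      factor \<open>1 / h\<close>.\<close>
    define e where "e j u = A * h powr (\<beta> - real j) * d j ((u - x) / h)" for j u
    have "(e j has_real_derivative e (Suc j) u) (at u within D)" if "j < m" for j u
    proof -
      have "((\<lambda>u. (u - x) / h) has_real_derivative 1 / h) (at u)"
        using h by (auto intro!: derivative_eq_intros)
      from DERIV_chain2[OF deriv this, of j] that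
      have "((\<lambda>u. A * h powr (\<beta> - real j) * d j ((u - x) / h)) has_real_derivative
          A * h powr (\<beta> - real j) * (d (Suc j) ((u - x) / h) * (1 / h))) (at u)"
        by (intro DERIV_cmult) auto
      moreover have "h powr (\<beta> - real (Suc j)) = h powr (\<beta> - real j) / h"
        using h powr_diff[of h "\<beta> - real j" 1] by (simp add: algebra_simps)
      ultimately have "(e j has_real_derivative e (Suc j) u) (at u)"
        unfolding e_def[abs_def] by (elim DERIV_cong) simp
      then show ?thesis
        by (rule has_field_derivative_at_within)
    qed
    moreover have "\<bar>e m y - e m z\<bar> \<le> L * \<bar>y - z\<bar> powr \<gamma>" for y z
    proof -
      have "\<bar>e m y - e m z\<bar> = A * h powr \<gamma> * \<bar>d m ((y - x) / h) - d m ((z - x) / h)\<bar>"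
        using A h by (simp add: e_def \<gamma>_def abs_mult flip: right_diff_distrib)
      also have "\<dots> \<le> A * h powr \<gamma> * (2 * C * \<bar>(y - x) / h - (z - x) / h\<bar> powr \<gamma>)"
        using A by (intro mult_left_mono hoelder) auto
      also have "\<bar>(y - x) / h - (z - x) / h\<bar> = \<bar>y - z\<bar> / h"
        using h by (simp add: abs_divide flip: diff_divide_distrib)
      also have "A * h powr \<gamma> * (2 * C * (\<bar>y - z\<bar> / h) powr \<gamma>) = L * \<bar>y - z\<bar> powr \<gamma>"
        using h C by (simp add: A_def powr_divide)
      finally show ?thesis .
    qed
    moreover have "e 0 u = A * h powr \<beta> * d 0 ((u - x) / h)" for u
      by (simp add: e_def)
    ultimately show "(\<lambda>u. A * h powr \<beta> * d 0 ((u - x) / h)) \<in> hoelder_class D L \<beta>"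
      unfolding hoelder_class_def mem_Collect_eq m_def[symmetric] \<gamma>_def[symmetric]
      by (intro exI[of _ e]) auto
  qed
qed

section \<open>The lower bound\<close>

lemma zero_in_coefficient_class:
  assumes "0 \<le> L" "0 \<le> \<rho>"
  shows "(\<lambda>_. 0) \<in> coefficient_class L \<beta> \<rho>"
  unfolding coefficient_class_def hoelder_class_def using assms
  by (auto intro!: exI[of _ "\<lambda>_ _. 0"])

lemma extend_coeff_eq: "0 \<le> u \<Longrightarrow> u \<le> 1 \<Longrightarrow> extend_coeff f u = f u"
  by (simp add: extend_coeff_def)

section \<open>Counting the shifted innovations and bounding products\<close>

lemma card_le_of_diff_le:
  fixes S :: "nat set"
  assumes "finite S" "0 \<le> w" "\<And>i j. i \<in> S \<Longrightarrow> j \<in> S \<Longrightarrow> real i - real j \<le> w"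
  shows "real (card S) \<le> w + 1"
proof (cases "S = {}")
  case False
  have "card S \<le> card {Min S..Max S}"
    using assms(1) by (intro card_mono) auto
  also have "\<dots> = Suc (Max S) - Min S"
    by simp
  finally have "real (card S) \<le> real (Max S) - real (Min S) + 1"
    using Min_le[OF assms(1) Max_in[OF assms(1) False]] by linarith
  also have "\<dots> \<le> w + 1"
    using assms False by simp
  finally show ?thesis .
qed (use assms in simp)

text \<open>From \<open>ln (1 - t) \<ge> - t - 2 * t^2\<close>, where the quadratic term is at most
  \<open>t\<close> on the given range.\<close>

lemma exp_le_one_minus:
  fixes t :: real
  assumes "0 \<le> t" "t \<le> 1 / 2"
  shows "exp (- 2 * t) \<le> 1 - t"
proof -
  have "2 * t\<^sup>2 \<le> t"
    using mult_left_mono[of t "1 / 2" t] assms by (simp add: power2_eq_square)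
  then have "- 2 * t \<le> ln (1 - t)"
    using ln_one_minus_pos_lower_bound[of t] assms by simp
  then show ?thesis
    using assms by (subst (asm) ln_ge_iff) auto
qed

text \<open>Factors off \<open>S\<close> equal 1, so the bound depends on the number of shifted
  innovations and not on \<open>N\<close>.\<close>

lemma prod_one_minus_ge:
  fixes g :: "nat \<Rightarrow> real"
  assumes g: "\<And>k. k < N \<Longrightarrow> 0 \<le> g k" "\<And>k. k < N \<Longrightarrow> g k \<le> t" and t: "t \<le> 1 / 2"
    and S: "S \<subseteq> {..<N}" "\<And>k. k < N \<Longrightarrow> k \<notin> S \<Longrightarrow> g k = 0"
  shows "exp (- 2 * (real (card S) * t)) \<le> (\<Prod>k<N. 1 - g k)"
proof -
  have "sum g {..<N} = sum g S"
    using S by (intro sum.mono_neutral_right) auto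
  also have "\<dots> \<le> real (card S) * t"
    using S(1) g(2) by (intro sum_bounded_above) auto
  finally have "exp (- 2 * (real (card S) * t)) \<le> exp (\<Sum>k<N. - 2 * g k)"
    by (simp add: sum_negf flip: sum_distrib_left)
  also have "\<dots> = (\<Prod>k<N. exp (- 2 * g k))"
    by (rule exp_sum) simp
  also have "\<dots> \<le> (\<Prod>k<N. 1 - g k)"
  proof (intro prod_mono conjI exp_le_one_minus)
    show "g k \<le> 1 / 2" if "k \<in> {..<N}" for k
      using g(2)[of k] t that by simp
  qed (use g in auto)
  finally show ?thesis .
qed

text \<open>Reduction of estimation to testing: reject the zero coefficient when the estimate
  exceeds \<open>r\<close> in absolute value. Since \<open>f x > 2 * r\<close>, accepting forces an
  error above \<open>r\<close> under \<open>f\<close>. The two errors add up to at most twice the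
  supremum, hence \<open>c / 2\<close>.\<close>

lemma estimation_error_ge:
  fixes f :: "real \<Rightarrow> real" and a r x :: real
  assumes a: "0 < a" and T: "T \<in> estimators N" and x: "x \<in> {0..1}" and r: "0 < r" "2 * r < f x"
    and test: "\<And>A. A \<in> sets (innov_prod a N) \<Longrightarrow> ennreal c \<le>
      emeasure (innov_space a) {\<epsilon> \<in> space (innov_space a). observations (\<lambda>_. 0) N \<epsilon> \<in> A} +
      emeasure (innov_space a) {\<epsilon> \<in> space (innov_space a). observations f N \<epsilon> \<notin> A}"
    and c: "0 \<le> c" and F: "(\<lambda>_. 0) \<in> F" "f \<in> F"
  shows "ennreal (c / 2) \<le> (SUP f\<in>F. emeasure (innov_space a)
    {\<epsilon> \<in> space (innov_space a). \<bar>T (observations f N \<epsilon>) x - f x\<bar> > r})"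
    (is "_ \<le> ?S")
proof -
  have [measurable]: "(\<lambda>y. T y x) \<in> borel_measurable (innov_prod a N)"
  proof -
    have "sets (innov_prod a N) = sets (Pi\<^sub>M {1..int N} (\<lambda>_. borel :: real measure))"
      by (rule sets_PiM_cong) auto
    moreover have "(\<lambda>y. T y x) \<in> borel_measurable (Pi\<^sub>M {1..int N} (\<lambda>_. borel))"
      using T x by (auto simp: estimators_def)
    ultimately show ?thesis
      using measurable_cong_sets[OF _ refl] by blast
  qed
  note [measurable] = observations_measurable
  define A where "A = {y \<in> space (innov_prod a N). \<bar>T y x\<bar> > r}"
  have A: "A \<in> sets (innov_prod a N)"
    unfolding A_def by measurable
  let ?E = "\<lambda>f. {\<epsilon> \<in> space (innov_space a). \<bar>T (observations f N \<epsilon>) x - f x\<bar> > r}"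
  have "ennreal c \<le>
      emeasure (innov_space a) {\<epsilon> \<in> space (innov_space a). observations (\<lambda>_. 0) N \<epsilon> \<in> A} +
      emeasure (innov_space a) {\<epsilon> \<in> space (innov_space a). observations f N \<epsilon> \<notin> A}"
    by (rule test[OF A])
  also have "\<dots> \<le> emeasure (innov_space a) (?E (\<lambda>_. 0)) + emeasure (innov_space a) (?E f)"
  proof (intro add_mono emeasure_mono)
    show "{\<epsilon> \<in> space (innov_space a). observations (\<lambda>_. 0) N \<epsilon> \<in> A} \<subseteq> ?E (\<lambda>_. 0)"
      by (auto simp: A_def)
    have "observations f N \<epsilon> \<in> space (innov_prod a N)" if "\<epsilon> \<in> space (innov_space a)" for \<epsilon>
      using measurable_space[OF observations_measurable that] .
    then show "{\<epsilon> \<in> space (innov_space a). observations f N \<epsilon> \<notin> A} \<subseteq> ?E f"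
      using r by (auto simp: A_def)
  qed measurable
  also have "\<dots> \<le> ?S + ?S"
    using F by (intro add_mono SUP_upper2[where i = "\<lambda>_. 0"] SUP_upper2[where i = f]) auto
  finally have S: "ennreal c \<le> ?S + ?S" .
  show ?thesis
  proof (cases ?S)
    case (real s)
    have "ennreal c \<le> ennreal (s + s)"
      using S real(1) unfolding real(2) by (simp only: ennreal_plus)
    then have "c \<le> s + s"
      by (rule ennreal_le_iff[THEN iffD1, rotated]) (use real(1) in simp)
    then show ?thesis
      unfolding real(2) by (intro ennreal_leI) simp
  next
    case top
    then show ?thesis
      by (simp only: top_greatest)
  qed
qed

theorem theorem2p4:
  fixes a L \<beta> \<rho> :: real
  assumes "0 < a" "a < 2" "0 < L" "0 < \<beta>" "0 < \<rho>" "\<rho> < 1"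
  shows "\<exists>\<mu>. innovation_law a \<mu> \<and>
    (\<forall>x\<in>{0..1}.
      liminf (\<lambda>N. INF T\<in>estimators N. SUP f\<in>coefficient_class L \<beta> \<rho>.
        emeasure (innovation_space \<mu>)
          {\<epsilon> \<in> space (innovation_space \<mu>).
             \<bar>T (observations f N \<epsilon>) x - f x\<bar> > real N powr (- (\<beta> / (a * \<beta> + 1)))}) > 0)"
proof (intro exI conjI ballI)
  note a = assms(1,2) and L = assms(3) and \<beta> = assms(4) and \<rho> = assms(5,6)
  show "innovation_law a (innov_measure a)"
    by (rule innovation_law_innov_measure[OF a(1)])
  fix x :: real assume x: "x \<in> {0..1}"
  obtain A \<psi> where A: "0 < A" and \<psi>: "\<And>u. 0 \<le> \<psi> u" "\<And>u. \<psi> u \<le> 1" "\<psi> 0 = (1::real)"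
      "\<And>u::real. 1 \<le> \<bar>u\<bar> \<Longrightarrow> \<psi> u = 0"
    and bump: "\<And>x h D. 0 < h \<Longrightarrow> (\<lambda>u. A * h powr \<beta> * \<psi> ((u - x) / h)) \<in> hoelder_class D L \<beta>"
    by (rule hoelder_class_bump[OF \<beta> L]) blast
  define s where "s = a * \<beta> + 1"
  have s: "0 < s" "1 < s"
    using a \<beta> by (auto simp: s_def add_pos_pos)
  \<comment> \<open>Chosen so that a bump of width \<open>h N\<close> has height
    \<open>3 * r N\<close>; the factor must exceed 2 for the strict separation of the
    hypotheses.\<close>
  define H where "H = (3 / A) powr (1 / \<beta>)"
  have H: "0 < H" "A * H powr \<beta> = 3"
    using A \<beta> by (auto simp: H_def powr_powr)
  define K where "K = hellinger_const a"
  have K: "0 < K"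
    unfolding K_def by (rule hellinger_const_pos[OF a])
  define M where "M = 1 / (1 - \<rho>)"
  have M: "0 < M"
    using \<rho> by (simp add: M_def)
  \<comment> \<open>Bounds \<open>2 * h N * real N + 1\<close>, the number of shifted innovations,
    times the affinity loss of one. It is free of \<open>N\<close> because
    \<open>h N * real N * r N powr a = H\<close> and \<open>r N \<le> 1\<close>.\<close>
  define Q where "Q = (2 * H + 1) * (K * (3 * M) powr a)"
  define r where "r N = real N powr (- (\<beta> / s))" for N :: nat
  define h where "h N = H * real N powr (- (1 / s))" for N :: nat
  have r0: "0 \<le> r N" for N
    by (simp add: r_def)
  have r_lim: "r \<longlonglongrightarrow> 0"
    unfolding r_def[abs_def] using \<beta> s
    by (intro tendsto_neg_powr filterlim_real_sequentially) auto
  have ra_lim: "(\<lambda>N. K * (3 * r N * M) powr a) \<longlonglongrightarrow> 0"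
  proof -
    have "(\<lambda>N. K * (3 * M) powr a * real N powr (- (\<beta> / s * a))) \<longlonglongrightarrow> K * (3 * M) powr a * 0"
      using \<beta> s a by (intro tendsto_mult_left tendsto_neg_powr filterlim_real_sequentially) auto
    moreover have "K * (3 * r N * M) powr a = K * (3 * M) powr a * real N powr (- (\<beta> / s * a))" for N
      using M by (simp add: r_def powr_mult powr_powr)
    ultimately show ?thesis
      by (simp only: mult_zero_right)
  qed
  \<comment> \<open>For large \<open>N\<close> the bump stays below \<rho>, the shifts stay below 1
    as the affinity bound requires, and each factor loses less than one half as the exponential
    bound requires.\<close>
  have "\<forall>\<^sub>F N in sequentially. 3 * r N < \<rho>"
    using tendsto_mult_left[OF r_lim, of 3] \<rho> by (intro order_tendstoD) auto
  moreover have "\<forall>\<^sub>F N in sequentially. 3 * r N * M < 1"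
    using tendsto_mult_right[OF tendsto_mult_left[OF r_lim, of 3], of M] by (intro order_tendstoD) auto
  moreover have "\<forall>\<^sub>F N in sequentially. K * (3 * r N * M) powr a < 1 / 2"
    using ra_lim by (intro order_tendstoD) auto
  moreover have "\<forall>\<^sub>F N in sequentially. 1 \<le> (N::nat)"
    by (rule eventually_ge_at_top)
  \<comment> \<open>The affinity is at least \<kappa> = \<open>exp (- 2 * Q)\<close>, the two errors
    add up to at least \<kappa>^2/2, and the larger is at least half of that.\<close>
  ultimately have "\<forall>\<^sub>F N in sequentially. ennreal ((exp (- 2 * Q))\<^sup>2 / 2 / 2) \<le>
      (INF T\<in>estimators N. SUP f\<in>coefficient_class L \<beta> \<rho>.
        emeasure (innov_space a)
          {\<epsilon> \<in> space (innov_space a). \<bar>T (observations f N \<epsilon>) x - f x\<bar> > r N})"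
  proof eventually_elim
    case (elim N)
    have N: "0 < real N"
      using elim by simp
    have h: "0 < h N" and r: "0 < r N"
      using H N by (auto simp: h_def r_def)
    have hr: "A * h N powr \<beta> = 3 * r N"
    proof -
      have "A * h N powr \<beta> = A * H powr \<beta> * real N powr (- (1 / s) * \<beta>)"
        using H by (simp add: h_def powr_mult powr_powr)
      then show ?thesis
        by (simp add: H r_def)
    qed
    define f where "f u = 3 * r N * \<psi> ((u - x) / h N)" for u
    have f: "0 \<le> f u" "f u \<le> 3 * r N" for u
      unfolding f_def using r \<psi> by (auto intro: mult_left_le)
    have f_\<rho>: "f u \<le> \<rho>" for u
      using f(2)[of u] elim(1) by linarith
    have f_class: "f \<in> coefficient_class L \<beta> \<rho>"
    proof -
      have "f \<in> hoelder_class {0..1} L \<beta>"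
        \<comment> \<open>Near an endpoint the bump sticks out of [0,1]; membership holds on every
          domain, so cutting it off is harmless.\<close>
        using bump[OF h, of x "{0..1}"] unfolding hr f_def[abs_def] .
      then show ?thesis
        unfolding coefficient_class_def using f(1) f_\<rho> by auto
    qed
    define b where "b k = extend_coeff f (real_of_int k / real N)" for k :: int
    have b: "0 \<le> b k" "b k \<le> 3 * r N" for k
      unfolding b_def extend_coeff_def using f by auto
    have bM: "b k * M \<le> 3 * r N * M" for k
      using b M by (intro mult_right_mono) auto
    define g where "g k = K * (b (int k + 1) * M) powr a" for k :: nat
    have g: "0 \<le> g k" "g k \<le> K * (3 * r N * M) powr a" for k
      unfolding g_def using K a b M bM by (auto intro!: mult_left_mono powr_mono2)
    \<comment> \<open>Index \<open>k\<close> stands for time \<open>k + 1\<close>, matching the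
      factors of the likelihood ratio.\<close>
    define S where "S = {k \<in> {..<N}. \<bar>(real k + 1) / real N - x\<bar> < h N}"
    have "exp (- 2 * Q) \<le> exp (- 2 * (real (card S) * (K * (3 * r N * M) powr a)))"
    proof -
      have "real (card S) \<le> 2 * h N * real N + 1"
      proof (rule card_le_of_diff_le)
        fix i j assume "i \<in> S" "j \<in> S"
        then have "(real i + 1) / real N - (real j + 1) / real N \<le> 2 * h N"
          unfolding S_def by auto
        then have "(real i - real j) / real N \<le> 2 * h N"
          by (simp add: diff_divide_distrib add_divide_distrib)
        then show "real i - real j \<le> 2 * h N * real N"
          using N by (simp add: pos_divide_le_eq)
      qed (use h in \<open>auto simp: S_def\<close>)
      then have "real (card S) * (K * (3 * r N * M) powr a) \<le>
          (2 * h N * real N + 1) * (K * (3 * r N * M) powr a)"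
        using K by (intro mult_right_mono) auto
      also have "\<dots> = (2 * (h N * real N * r N powr a) + r N powr a) * (K * (3 * M) powr a)"
        using r M by (simp add: powr_mult algebra_simps)
      also have "h N * real N * r N powr a = H"
      proof -
        have "h N * real N * r N powr a = H * real N powr (- (1 / s) + 1 + - (\<beta> / s) * a)"
          unfolding h_def r_def using less_imp_le[OF N]
          by (simp only: powr_add powr_powr powr_one mult_ac)
        \<comment> \<open>This balance of width, sample size and loss per step fixes the exponent of
          the rate: \<open>s = a * \<beta> + 1\<close>.\<close>
        also have "- (1 / s) + 1 + - (\<beta> / s) * a = 0"
          using s by (simp add: field_simps) (simp add: s_def algebra_simps)
        finally show ?thesis
          using N by simp
      qed
      also have "(2 * H + r N powr a) * (K * (3 * M) powr a) \<le> Q"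
        unfolding Q_def
      proof (intro mult_right_mono add_left_mono)
        have "r N \<le> real N powr 0"
          unfolding r_def using elim \<beta> s by (intro powr_mono) auto
        then show "r N powr a \<le> 1"
          using N r a by (intro powr_le1) auto
      qed (use K in auto)
      finally show ?thesis
        by simp
    qed
    also have "\<dots> \<le> (\<Prod>k<N. 1 - g k)"
    proof (rule prod_one_minus_ge)
      show "g k = 0" if "k < N" "k \<notin> S" for k
      proof -
        have "b (int k + 1) = extend_coeff f ((real k + 1) / real N)"
          by (simp add: b_def)
        also have "\<dots> = f ((real k + 1) / real N)"
          by (rule extend_coeff_eq) (use that in auto)
        also have "\<dots> = 0"
          using that h \<psi>(4) by (simp add: f_def S_def abs_divide)
        finally show ?thesis
          by (simp add: g_def)
      qed
    qed (use g elim in \<open>auto simp: S_def\<close>)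
    finally have prod: "exp (- 2 * Q) \<le> (\<Prod>k<N. 1 - g k)" .
    show ?case
    proof (rule INF_greatest)
      fix T assume T: "T \<in> estimators N"
      show "ennreal ((exp (- 2 * Q))\<^sup>2 / 2 / 2) \<le> (SUP f\<in>coefficient_class L \<beta> \<rho>.
          emeasure (innov_space a)
            {\<epsilon> \<in> space (innov_space a). \<bar>T (observations f N \<epsilon>) x - f x\<bar> > r N})"
      proof (rule estimation_error_ge[OF a(1) T x r])
        show "2 * r N < f x"
          using r by (simp add: f_def \<psi>)
        show "(\<lambda>_. 0) \<in> coefficient_class L \<beta> \<rho>"
          using L \<rho> by (intro zero_in_coefficient_class) auto
        fix A' assume A': "A' \<in> sets (innov_prod a N)"
        show "ennreal ((exp (- 2 * Q))\<^sup>2 / 2) \<le>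
          emeasure (innov_space a) {\<epsilon> \<in> space (innov_space a). observations (\<lambda>_. 0) N \<epsilon> \<in> A'} +
          emeasure (innov_space a) {\<epsilon> \<in> space (innov_space a). observations f N \<epsilon> \<notin> A'}"
        proof (rule two_point_process_bound[OF a, where \<rho> = \<rho>])
          show "0 \<le> extend_coeff f u" "extend_coeff f u \<le> \<rho>" for u
            unfolding extend_coeff_def using f(1) f_\<rho> by auto
          show "extend_coeff f (real_of_int k / real N) * (1 / (1 - \<rho>)) \<le> 1" for k
            using bM[of k] elim(2) unfolding b_def M_def by linarith
          have "K * (b k * M) powr a \<le> 1" for k
          proof -
            have "K * (b k * M) powr a \<le> K * (3 * r N * M) powr a"
              using K a b M bM by (intro mult_left_mono powr_mono2) auto
            with elim(3) show ?thesis
              by linarith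
          qed
          then show "hellinger_const a * (extend_coeff f (real_of_int k / real N) * (1 / (1 - \<rho>))) powr a \<le> 1" for k
            unfolding b_def M_def K_def .
          show "exp (- 2 * Q) \<le> (\<Prod>k<N. 1 - hellinger_const a *
              (extend_coeff f (real_of_int (int k + 1) / real N) * (1 / (1 - \<rho>))) powr a)"
            using prod unfolding g_def b_def M_def K_def .
        qed (use \<rho> A' in auto)
      qed (use f_class in auto)
    qed
  qed
  then have "ennreal ((exp (- 2 * Q))\<^sup>2 / 2 / 2) \<le>
      liminf (\<lambda>N. INF T\<in>estimators N. SUP f\<in>coefficient_class L \<beta> \<rho>.
        emeasure (innov_space a)
          {\<epsilon> \<in> space (innov_space a). \<bar>T (observations f N \<epsilon>) x - f x\<bar> > r N})"
    by (rule Liminf_bounded)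
  moreover have "0 < ennreal ((exp (- 2 * Q))\<^sup>2 / 2 / 2)"
    by simp
  ultimately show "0 < liminf (\<lambda>N. INF T\<in>estimators N. SUP f\<in>coefficient_class L \<beta> \<rho>.
        emeasure (innov_space a)
          {\<epsilon> \<in> space (innov_space a).
             \<bar>T (observations f N \<epsilon>) x - f x\<bar> > real N powr (- (\<beta> / (a * \<beta> + 1)))})"
    unfolding r_def s_def by (rule less_le_trans[rotated])
qed

end
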